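(* In the trilevel setting, let $\Omega:=\{x\in\mathrm{Fix}(W):\langle (I-T)x,y-x\rangle\ge0\ \forall y\in\mathrm{Fix}(W)\}$ be nonempty. Assume $\lim_{k\to\infty}\beta_k/\alpha_k=+\infty$, $\alpha_k\to0$, $\sum_k\alpha_k=\infty$, there is $K>0$ with $\limsup_{k}\frac1{\alpha_k}\left|\frac1{\beta_k}-\frac1{\beta_{k-1}}\right|\le K$, $\limsup_{k}\frac{|\beta_k-\beta_{k-1}|+|\alpha_k-\alpha_{k-1}|}{\alpha_k\beta_k}=0$, and that the trilevel iteration sequence $\{x^k\}$ is bounded. Suppose further $(A_1)'$ $\limsup_{k\to\infty}\frac{d(x^{k+1},\mathrm{Fix}(W))}{\beta_k}=0$, and $(A_2)$ $\limsup_{k\to\infty}\beta_k^2/\alpha_k<\infty$. Then $\{x^k\}$ converges to the unique $x^*\in\Omega$ satisfying $\langle x^*-S(x^* ),x-x^*\rangle\ge0$ for all $x\in\Omega$.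
   Context: Trilevel setting. Let $f_1,f_2:\mathbb R^n\to\mathbb R$ be convex and continuously differentiable with $L_{f_i}$-Lipschitz gradients, and $g_1,g_2:\mathbb R^n\to(-\infty,+\infty]$ proper, lower semicontinuous and convex; put $\phi_i=f_i+g_i$. Let $\omega:\mathbb R^n\to\mathbb R$ be $\mu$-strongly convex and continuously differentiable with $L_\omega$-Lipschitz gradient. Let $Y^*=\arg\min_{x\in\mathbb R^n}\phi_2(x)$ and $X^*=\arg\min_{x\in Y^*}\phi_1(x)$, both assumed nonempty. For a proper lsc convex $g$, $\mathrm{prox}_g(x)=\arg\min_{u}\{g(u)+\tfrac12\|u-x\|^2\}$. Fix $u\in(0,\tfrac{2}{L_\omega+\mu}]$, $t\in(0,1/L_{f_1}]$, $s\in(0,1/L_{f_2}]$ and define $S(x)=x-u\nabla\omega(x)$, $T(x)=\mathrm{prox}_{tg_1}(x-t\nabla f_1(x))$, $W(x)=\mathrm{prox}_{sg_2}(x-s\nabla f_2(x))$. Then $S$ is a contraction with constant $r=\sqrt{1-\tfrac{2u\mu L_\omega}{\mu+L_\omega}}\in[0,1)$, $T,W$ are nonexpansive, $\mathrm{Fix}(W)=Y^*$. Given $x^0\in\mathbb R^n$ and real sequences $\alpha_k,\beta_k\in(0,1)$, the trilevel iteration sequence is $x^{k+1}=\alpha_kS(x^k)+(1-\alpha_k)\beta_kT(x^k)+(1-\alpha_k)(1-\beta_k)W(x^k)$, $k\ge0$. $I$ is the identity, $d(x,A)=\inf_{a\in A}\|x-a\|$. *)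

theory Defs
  imports "HOL-Analysis.Analysis"
begin

definition proper_fun :: "('a \<Rightarrow> ereal) \<Rightarrow> bool" where
  "proper_fun g \<longleftrightarrow> (\<forall>x. g x \<noteq> -\<infinity>) \<and> (\<exists>x. g x \<noteq> \<infinity>)"

definition lsc_fun :: "('a::topological_space \<Rightarrow> ereal) \<Rightarrow> bool" where
  "lsc_fun g \<longleftrightarrow> (\<forall>x. g x \<le> Liminf (at x) g)"

definition ereal_convex :: "('a::real_vector \<Rightarrow> ereal) \<Rightarrow> bool" where
  "ereal_convex g \<longleftrightarrow>
     (\<forall>x y. \<forall>\<theta>::real. 0 \<le> \<theta> \<and> \<theta> \<le> 1 \<longrightarrow>
        g ((1 - \<theta>) *\<^sub>R x + \<theta> *\<^sub>R y) \<le> ereal (1 - \<theta>) * g x + ereal \<theta> * g y)"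

definition prox :: "('a::real_normed_vector \<Rightarrow> ereal) \<Rightarrow> 'a \<Rightarrow> 'a" where
  "prox g x = (THE p. \<forall>v. g p + ereal (1/2 * (norm (p - x))\<^sup>2) \<le> g v + ereal (1/2 * (norm (v - x))\<^sup>2))"

definition Fix :: "('a \<Rightarrow> 'a) \<Rightarrow> 'a set" where
  "Fix F = {x. F x = x}"

definition strongly_convex :: "real \<Rightarrow> ('a::real_normed_vector \<Rightarrow> real) \<Rightarrow> bool" where
  "strongly_convex \<mu> w \<longleftrightarrow>
     (\<forall>x y. \<forall>\<theta>::real. 0 \<le> \<theta> \<and> \<theta> \<le> 1 \<longrightarrow>
        w ((1 - \<theta>) *\<^sub>R x + \<theta> *\<^sub>R y) \<le> (1 - \<theta>) * w x + \<theta> * w y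
          - \<mu> / 2 * \<theta> * (1 - \<theta>) * (norm (x - y))\<^sup>2)"

end

theory Submission
  imports Defs
begin

text \<open>
  Comparing consecutive iterates, \<open>z k = \<parallel>x (k+1) - x k\<parallel>\<close> satisfies a contractive recursion with rate
  \<open>(1 - r) \<alpha>\<close>; Xu's lemma on such recursions gives first \<open>z \<longlongrightarrow> 0\<close> and then, after division by
  \<open>\<beta> k\<close>, \<open>z / \<beta> \<longlongrightarrow> 0\<close>. Hence limit points of \<open>x\<close> lie in \<open>Fix W\<close>, and dividing the iteration by \<open>\<beta> k\<close>
  and pairing it with \<open>x k - y\<close> for \<open>y \<in> Fix W\<close> puts them in \<open>\<Omega>\<close>. As \<open>Fix W\<close> and \<open>\<Omega>\<close> are solution sets of
  monotone variational inequalities, they are closed and convex, and \<open>x\<^sup>*\<close> is the fixed point of the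
  contraction \<open>P\<^sub>\<Omega> \<circ> S\<close>. In the recursion for \<open>\<parallel>x k - x\<^sup>*\<parallel>\<^sup>2\<close> the term
  \<open>\<beta> k \<langle>T x\<^sup>* - x\<^sup>*, x (k+1) - x\<^sup>*\<rangle>\<close> is at most \<open>\<beta> k \<parallel>x\<^sup>* - T x\<^sup>*\<parallel> d (x (k+1), Fix W)\<close>, which is
  \<open>o(\<beta>\<^sup>2) = o(\<alpha>)\<close> by the last two hypotheses, so Xu's lemma applies once more.
\<close>

section \<open>Contractive recursions for real sequences\<close>

text \<open>Once \<open>\<delta> k \<le> e\<close>, the excess of \<open>a\<close> over
  \<open>e\<close> is multiplied by at most \<open>1 - \<gamma> k \<le> exp (- \<gamma> k)\<close>
  in each step, so it is dominated by the exponential of minus a divergent sum. The condition on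
  \<open>\<delta>\<close> is one-sided because in the final application \<open>\<delta>\<close>
  contains an inner product of unknown sign.\<close>

lemma Xu_recursion_tendsto_0:
  fixes a \<gamma> \<delta> :: "nat \<Rightarrow> real"
  assumes nonneg: "\<And>k. 0 \<le> a k"
    and \<gamma>: "\<And>k. 0 \<le> \<gamma> k" "\<And>k. \<gamma> k \<le> 1"
    and sum: "filterlim (\<lambda>n. \<Sum>k<n. \<gamma> k) at_top sequentially"
    and \<delta>: "\<And>e. 0 < e \<Longrightarrow> \<forall>\<^sub>F k in sequentially. \<delta> k \<le> e"
    and rec: "\<And>k. a (Suc k) \<le> (1 - \<gamma> k) * a k + \<gamma> k * \<delta> k"
  shows "a \<longlonglongrightarrow> 0"
proof (rule LIMSEQ_I)
  fix r :: real assume "0 < r"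
  define e where "e = r / 2"
  have e: "0 < e" "r = 2 * e" using \<open>0 < r\<close> by (auto simp: e_def)
  obtain N where N: "\<And>k. k \<ge> N \<Longrightarrow> \<delta> k \<le> e"
    using \<delta>[OF e(1)] by (auto simp: eventually_sequentially)
  have bound: "a (N + n) \<le> e + exp (- (\<Sum>k<n. \<gamma> (N + k))) * a N" for n
  proof (induction n)
    case 0
    then show ?case using e by simp
  next
    case (Suc n)
    have "a (N + Suc n) \<le> (1 - \<gamma> (N + n)) * a (N + n) + \<gamma> (N + n) * \<delta> (N + n)"
      using rec[of "N + n"] by simp
    also have "\<dots> \<le> (1 - \<gamma> (N + n)) * (e + exp (- (\<Sum>k<n. \<gamma> (N + k))) * a N) + \<gamma> (N + n) * e"
      using Suc N[of "N + n"] \<gamma>[of "N + n"] by (intro add_mono mult_left_mono) auto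
    also have "\<dots> = e + (1 - \<gamma> (N + n)) * (exp (- (\<Sum>k<n. \<gamma> (N + k))) * a N)"
      by (simp add: algebra_simps)
    also have "\<dots> \<le> e + exp (- \<gamma> (N + n)) * (exp (- (\<Sum>k<n. \<gamma> (N + k))) * a N)"
      using exp_ge_add_one_self[of "- \<gamma> (N + n)"] nonneg[of N]
      by (intro add_left_mono mult_right_mono) auto
    also have "\<dots> = e + exp (- (\<Sum>k<Suc n. \<gamma> (N + k))) * a N"
      by (simp add: exp_add exp_minus exp_diff field_simps)
    finally show ?case .
  qed
  \<comment> \<open>Dropping the first \<open>N\<close> terms leaves a sum that still
    diverges.\<close>
  have split_sum: "(\<Sum>k<n + N. \<gamma> k) - (\<Sum>k<N. \<gamma> k) = (\<Sum>k<n. \<gamma> (N + k))" for n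
    by (induction n) (auto simp: add.commute)
  have "filterlim (\<lambda>n. - (\<Sum>k<N. \<gamma> k) + (\<Sum>k<n + N. \<gamma> k)) at_top sequentially"
    by (intro filterlim_tendsto_add_at_top[OF tendsto_const]
          filterlim_compose[OF sum filterlim_add_const_nat_at_top])
  then have "filterlim (\<lambda>n. \<Sum>k<n. \<gamma> (N + k)) at_top sequentially"
    by (simp add: split_sum[symmetric])
  then have "filterlim (\<lambda>n. - (\<Sum>k<n. \<gamma> (N + k))) at_bot sequentially"
    by (simp add: filterlim_uminus_at_bot)
  then have "(\<lambda>n. exp (- (\<Sum>k<n. \<gamma> (N + k))) * a N) \<longlonglongrightarrow> 0 * a N"
    by (intro tendsto_mult_right filterlim_compose[OF exp_at_bot])
  then have "\<forall>\<^sub>F n in sequentially. exp (- (\<Sum>k<n. \<gamma> (N + k))) * a N < e"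
    using e by (intro order_tendstoD(2)) auto
  then obtain M where M: "\<And>n. n \<ge> M \<Longrightarrow> exp (- (\<Sum>k<n. \<gamma> (N + k))) * a N < e"
    by (auto simp: eventually_sequentially)
  have "norm (a n - 0) < r" if "n \<ge> N + M" for n
  proof -
    have "a (N + (n - N)) < r"
      using bound[of "n - N"] M[of "n - N"] that e by linarith
    then show ?thesis using that nonneg[of n] by simp
  qed
  then show "\<exists>M. \<forall>n\<ge>M. norm (a n - 0) < r" by blast
qed

section \<open>Gradient steps\<close>

text \<open>Divide the strong convexity inequality on the segment from \<open>x\<close> to
  \<open>y\<close> by \<theta> and let \<theta> tend to 0 from the right. No sign of \<mu> is
  assumed, so \<mu> = 0 yields the gradient inequality of convex functions.\<close>

lemma strongly_convex_lower_bound: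
  fixes h :: "'a::real_inner \<Rightarrow> real"
  assumes sc: "strongly_convex \<mu> h"
    and grad: "(h has_derivative (\<lambda>v. g \<bullet> v)) (at x)"
  shows "h x + g \<bullet> (y - x) + \<mu> / 2 * (norm (y - x))\<^sup>2 \<le> h y"
proof -
  define \<phi> where "\<phi> = (\<lambda>\<theta>. h (x + \<theta> *\<^sub>R (y - x)))"
  have "(\<phi> has_derivative (\<lambda>\<theta>. g \<bullet> (\<theta> *\<^sub>R (y - x)))) (at 0)"
    unfolding \<phi>_def
    by (rule has_derivative_compose[where g = h and f = "\<lambda>\<theta>. x + \<theta> *\<^sub>R (y - x)"])
       (auto intro!: derivative_eq_intros simp: grad)
  then have "(\<phi> has_field_derivative (g \<bullet> (y - x))) (at 0)"
    by (simp add: has_field_derivative_def mult_commute_abs)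
  then have lim: "((\<lambda>\<theta>. (\<phi> \<theta> - \<phi> 0) / \<theta>) \<longlongrightarrow> g \<bullet> (y - x)) (at_right 0)"
    by (auto simp: has_field_derivative_iff intro: tendsto_within_subset)
  have lim2: "((\<lambda>\<theta>. h y - h x - \<mu> / 2 * (1 - \<theta>) * (norm (x - y))\<^sup>2)
      \<longlongrightarrow> h y - h x - \<mu> / 2 * (1 - 0) * (norm (x - y))\<^sup>2) (at_right 0)"
    by (intro tendsto_intros)
  have "\<forall>\<^sub>F \<theta> in at_right 0. (\<phi> \<theta> - \<phi> 0) / \<theta> \<le> h y - h x - \<mu> / 2 * (1 - \<theta>) * (norm (x - y))\<^sup>2"
    using eventually_at_right_real[of 0 "1::real", OF zero_less_one]
  proof eventually_elim
    case (elim \<theta>)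
    then have \<theta>: "0 < \<theta>" "\<theta> \<le> 1" by auto
    have "\<phi> \<theta> \<le> (1 - \<theta>) * h x + \<theta> * h y - \<mu> / 2 * \<theta> * (1 - \<theta>) * (norm (x - y))\<^sup>2"
      using sc[unfolded strongly_convex_def, rule_format, of \<theta> x y] \<theta>
      by (simp add: \<phi>_def algebra_simps)
    then have "\<phi> \<theta> - \<phi> 0 \<le> (h y - h x - \<mu> / 2 * (1 - \<theta>) * (norm (x - y))\<^sup>2) * \<theta>"
      by (simp add: \<phi>_def algebra_simps)
    then show ?case using \<theta> by (simp add: pos_divide_le_eq)
  qed
  from tendsto_le[OF _ lim2 lim this] show ?thesis
    by (simp add: norm_minus_commute)
qed

lemma strongly_convex_0_if_convex_on:
  assumes "convex_on UNIV h"
  shows "strongly_convex 0 h"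
  using assms by (auto simp: strongly_convex_def intro: convex_onD)

text \<open>Along the segment, \<open>h\<close> minus its claimed quadratic upper model has
  nonpositive derivative, by Cauchy-Schwarz and the Lipschitz bound. Monotonicity thus replaces an
  integral of the gradient.\<close>

lemma descent_upper_bound:
  fixes h :: "'a::real_inner \<Rightarrow> real"
  assumes grad: "\<And>z. (h has_derivative (\<lambda>v. g z \<bullet> v)) (at z)"
    and lip: "\<And>y z. norm (g y - g z) \<le> L * norm (y - z)"
  shows "h y \<le> h x + g x \<bullet> (y - x) + L / 2 * (norm (y - x))\<^sup>2"
proof -
  define d where "d = y - x"
  define \<phi> where "\<phi> = (\<lambda>\<theta>. h (x + \<theta> *\<^sub>R d) - \<theta> * (g x \<bullet> d) - L / 2 * \<theta>\<^sup>2 * (norm d)\<^sup>2)"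
  have der: "(\<phi> has_field_derivative (g (x + \<theta> *\<^sub>R d) \<bullet> d - g x \<bullet> d - L * \<theta> * (norm d)\<^sup>2)) (at \<theta>)" for \<theta>
  proof -
    have "((\<lambda>\<theta>. h (x + \<theta> *\<^sub>R d)) has_derivative (\<lambda>t. g (x + \<theta> *\<^sub>R d) \<bullet> (t *\<^sub>R d))) (at \<theta>)"
      by (rule has_derivative_compose[where g = h and f = "\<lambda>\<theta>. x + \<theta> *\<^sub>R d"])
         (auto intro!: derivative_eq_intros simp: grad)
    then have "((\<lambda>\<theta>. h (x + \<theta> *\<^sub>R d)) has_field_derivative (g (x + \<theta> *\<^sub>R d) \<bullet> d)) (at \<theta>)"
      by (simp add: has_field_derivative_def mult_commute_abs)
    then show ?thesis
      unfolding \<phi>_def by (auto intro!: derivative_eq_intros)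
  qed
  have "\<phi> 1 \<le> \<phi> 0"
  proof (rule DERIV_nonpos_imp_nonincreasing[where f = \<phi>])
    fix \<theta> :: real assume \<theta>: "0 \<le> \<theta>" "\<theta> \<le> 1"
    have "g (x + \<theta> *\<^sub>R d) \<bullet> d - g x \<bullet> d \<le> norm (g (x + \<theta> *\<^sub>R d) - g x) * norm d"
      using norm_cauchy_schwarz[of "g (x + \<theta> *\<^sub>R d) - g x" d] by (simp add: inner_diff_left)
    also have "\<dots> \<le> L * norm (\<theta> *\<^sub>R d) * norm d"
      using lip[of "x + \<theta> *\<^sub>R d" x] by (intro mult_right_mono) auto
    also have "\<dots> = L * \<theta> * (norm d)\<^sup>2"
      using \<theta> by (simp add: power2_eq_square)
    finally show "\<exists>D. (\<phi> has_real_derivative D) (at \<theta>) \<and> D \<le> 0"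
      using der[of \<theta>] by auto
  qed simp
  then show ?thesis by (simp add: \<phi>_def d_def)
qed

text \<open>Cocoercivity of the gradient: adding the sharpened lower bounds for
  \<open>(x, y)\<close> and \<open>(y, x)\<close> cancels the function values. The hypotheses are
  the two quadratic bounds rather than derivatives, so that the lemma also applies to
  \<open>w\<close> minus a multiple of the squared norm.\<close>

lemma Baillon_Haddad:
  fixes h :: "'a::real_inner \<Rightarrow> real"
  assumes lower: "\<And>x y. h x + g x \<bullet> (y - x) \<le> h y"
    and upper: "\<And>x y. h y \<le> h x + g x \<bullet> (y - x) + L / 2 * (norm (y - x))\<^sup>2"
    and "0 \<le> L"
  shows "(norm (g x - g y))\<^sup>2 \<le> L * ((g x - g y) \<bullet> (x - y))"
proof -
  \<comment> \<open>\<open>h - g x \<bullet> (_)\<close> is minimal at \<open>x\<close>; compare with a gradient step of length \<open>\<tau>\<close> from \<open>y\<close>.\<close>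
  have half: "h x + g x \<bullet> (y - x) \<le> h y - (\<tau> - L * \<tau>\<^sup>2 / 2) * (norm (g y - g x))\<^sup>2" for x y \<tau>
  proof -
    define v where "v = \<tau> *\<^sub>R (g y - g x)"
    have "h x + g x \<bullet> (y - v - x) \<le> h (y - v)" by (rule lower)
    also have "\<dots> \<le> h y + g y \<bullet> (- v) + L / 2 * (norm v)\<^sup>2"
      using upper[where y = "y - v" and x = y] by simp
    finally have "h x + g x \<bullet> (y - x) \<le> h y - (g y - g x) \<bullet> v + L / 2 * (norm v)\<^sup>2"
      by (simp add: inner_simps)
    also have "(g y - g x) \<bullet> v = \<tau> * (norm (g y - g x))\<^sup>2"
      by (simp add: v_def power2_norm_eq_inner)
    also have "(norm v)\<^sup>2 = \<tau>\<^sup>2 * (norm (g y - g x))\<^sup>2"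
      by (simp add: v_def power_mult_distrib)
    finally show ?thesis by (simp add: algebra_simps)
  qed
  define D where "D = (norm (g x - g y))\<^sup>2"
  have main: "(2 * \<tau> - L * \<tau>\<^sup>2) * D \<le> (g x - g y) \<bullet> (x - y)" for \<tau>
    using half[of x y \<tau>] half[of y x \<tau>]
    by (simp add: D_def norm_minus_commute[of "g y" "g x"] inner_simps algebra_simps)
  show ?thesis
  \<comment> \<open>For \<open>L > 0\<close> the best step is \<open>\<tau> = 1 / L\<close>. For
    \<open>L = 0\<close> the factor \<open>2 * \<tau>\<close> is unbounded, and a \<tau> that makes
    the left side exceed the right side by 1 rules out \<open>D \<noteq> 0\<close>. This case occurs
    below when \<mu> = L.\<close>
  proof (cases "L = 0")
    case True
    have "D = 0"
    proof (rule ccontr)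
      assume "D \<noteq> 0"
      then show False
        using main[of "(((g x - g y) \<bullet> (x - y)) + 1) / (2 * D)"] True by simp
    qed
    then show ?thesis using True by (simp add: D_def)
  next
    case False
    then have "L > 0" using \<open>0 \<le> L\<close> by simp
    then show ?thesis
      using main[of "1 / L"] by (simp add: D_def field_simps power2_eq_square)
  qed
qed

text \<open>In the expanded square, the cross term \<open>- 2 * t * (G \<bullet> d)\<close> absorbs
  the term quadratic in \<open>G\<close> by cocoercivity, since
  \<open>t \<le> 2 / L\<close>.\<close>

lemma gradient_step_nonexpansive:
  fixes f :: "'a::real_inner \<Rightarrow> real"
  assumes "convex_on UNIV f"
    and grad: "\<And>z. (f has_derivative (\<lambda>h. g z \<bullet> h)) (at z)"
    and lip: "\<And>y z. norm (g y - g z) \<le> L * norm (y - z)"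
    and "0 < L" "0 \<le> t" "t \<le> 2 / L"
  shows "norm ((x - t *\<^sub>R g x) - (y - t *\<^sub>R g y)) \<le> norm (x - y)"
proof -
  define d G where "d = x - y" and "G = g x - g y"
  have "(norm G)\<^sup>2 \<le> L * (G \<bullet> d)"
    unfolding d_def G_def
  proof (rule Baillon_Haddad)
    show "f x + g x \<bullet> (y - x) \<le> f y" for x y
      using strongly_convex_lower_bound[OF strongly_convex_0_if_convex_on[OF assms(1)] grad, of x y] by simp
  qed (use descent_upper_bound[OF grad lip] \<open>0 < L\<close> in auto)
  then have "t * (t * (norm G)\<^sup>2) \<le> t * (2 / L * (L * (G \<bullet> d)))"
    using assms by (intro mult_left_mono mult_mono) auto
  also have "\<dots> = 2 * t * (G \<bullet> d)" using \<open>0 < L\<close> by simp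
  finally have 1: "t * (t * (norm G)\<^sup>2) \<le> 2 * t * (G \<bullet> d)" .
  have "(norm (d - t *\<^sub>R G))\<^sup>2 = (norm d)\<^sup>2 - 2 * t * (G \<bullet> d) + t * (t * (norm G)\<^sup>2)"
    unfolding power2_norm_eq_inner by (simp add: inner_simps inner_commute)
  also have "\<dots> \<le> (norm d)\<^sup>2" using 1 by simp
  finally have "norm (d - t *\<^sub>R G) \<le> norm d" by (rule power2_le_imp_le) simp
  then show ?thesis by (simp add: d_def G_def algebra_simps)
qed

text \<open>The two quadratic models of \<open>w\<close> at 0 enclose its value at a unit vector,
  which exists because a Euclidean space has a nonempty basis.\<close>

lemma strongly_convex_modulus_le_Lipschitz:
  fixes w :: "'a::euclidean_space \<Rightarrow> real"
  assumes sc: "strongly_convex \<mu> w"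
    and grad: "\<And>z. (w has_derivative (\<lambda>h. g z \<bullet> h)) (at z)"
    and lip: "\<And>y z. norm (g y - g z) \<le> L * norm (y - z)"
  shows "\<mu> \<le> L"
proof -
  obtain b :: 'a where "b \<in> Basis" using nonempty_Basis by blast
  then have "norm b = 1" by simp
  then show ?thesis
    using strongly_convex_lower_bound[OF sc grad, of 0 b] descent_upper_bound[OF grad lip, of b 0] by simp
qed

text \<open>The constant is \<open>sqrt (1 - 2 * u * \<mu> * L / (L + \<mu>))\<close>. The
  inequality \<open>coerc\<close> controls the squared norms of both the gradient difference and the
  displacement: the first absorbs the term quadratic in \<open>u\<close> because
  \<open>u \<le> 2 / (L + \<mu>)\<close>, the second supplies the contraction factor.\<close>

lemma gradient_step_contraction:
  fixes w :: "'a::euclidean_space \<Rightarrow> real"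
  assumes sc: "strongly_convex \<mu> w" and "0 < \<mu>"
    and grad: "\<And>z. (w has_derivative (\<lambda>h. g z \<bullet> h)) (at z)"
    and lip: "\<And>y z. norm (g y - g z) \<le> L * norm (y - z)"
    and u: "0 < u" "u \<le> 2 / (L + \<mu>)"
  obtains r where "0 \<le> r" "r < 1"
    "\<And>x y. norm ((x - u *\<^sub>R g x) - (y - u *\<^sub>R g y)) \<le> r * norm (x - y)"
proof -
  have "\<mu> \<le> L" using strongly_convex_modulus_le_Lipschitz[OF sc grad lip] .
  then have "0 < L" "0 < L + \<mu>" using \<open>0 < \<mu>\<close> by auto
  \<comment> \<open>\<open>h = w - \<mu>/2 \<parallel>\<cdot>\<parallel>\<^sup>2\<close> is convex and \<open>(L - \<mu>)\<close>-smooth.\<close>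
  have coerc: "(norm (g x - g y))\<^sup>2 + \<mu> * L * (norm (x - y))\<^sup>2 \<le> (L + \<mu>) * ((g x - g y) \<bullet> (x - y))" for x y
  proof -
    define h where "h = (\<lambda>x. w x - \<mu> / 2 * (norm x)\<^sup>2)"
    define gh where "gh = (\<lambda>x. g x - \<mu> *\<^sub>R x)"
    have rem: "h y - h x - gh x \<bullet> (y - x) = w y - w x - g x \<bullet> (y - x) - \<mu> / 2 * (norm (y - x))\<^sup>2" for x y
      unfolding h_def gh_def power2_norm_eq_inner
      by (simp add: inner_simps inner_commute algebra_simps)
    have "(norm (gh x - gh y))\<^sup>2 \<le> (L - \<mu>) * ((gh x - gh y) \<bullet> (x - y))"
    proof (rule Baillon_Haddad)
      show "h x + gh x \<bullet> (y - x) \<le> h y" for x y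
        using strongly_convex_lower_bound[OF sc grad, of x y] rem[of y x] by linarith
      show "h y \<le> h x + gh x \<bullet> (y - x) + (L - \<mu>) / 2 * (norm (y - x))\<^sup>2" for x y
        using descent_upper_bound[OF grad lip, of y x] rem[of y x]
        by (simp add: left_diff_distrib diff_divide_distrib)
    qed (use \<open>\<mu> \<le> L\<close> in simp)
    moreover have "gh x - gh y = (g x - g y) - \<mu> *\<^sub>R (x - y)"
      by (simp add: gh_def algebra_simps)
    ultimately show ?thesis
      unfolding power2_norm_eq_inner
      by (simp add: inner_simps inner_commute algebra_simps)
  qed
  define q where "q = 1 - 2 * u * \<mu> * L / (L + \<mu>)"
  have "q < 1" using \<open>0 < L\<close> \<open>0 < \<mu>\<close> u by (simp add: q_def)
  \<comment> \<open>Nonnegativity of \<open>q\<close> at the largest admissible \<open>u\<close> is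
    the inequality \<open>4 * \<mu> * L \<le> (L + \<mu>)\<^sup>2\<close>.\<close>
  have "u * (2 * \<mu> * L / (L + \<mu>)) \<le> 2 / (L + \<mu>) * (2 * \<mu> * L / (L + \<mu>))"
    using u \<open>0 < L\<close> \<open>0 < \<mu>\<close> by (intro mult_right_mono) auto
  also have "\<dots> = 4 * \<mu> * L / (L + \<mu>)\<^sup>2" by (simp add: power2_eq_square)
  also have "\<dots> \<le> 1"
    using \<open>0 < L + \<mu>\<close> zero_le_power2[of "L - \<mu>"]
    by (subst divide_le_eq_1_pos) (simp, simp add: power2_eq_square algebra_simps)
  finally have "0 \<le> q" by (simp add: q_def algebra_simps)
  show ?thesis
  proof
    show "0 \<le> sqrt q" "sqrt q < 1" using \<open>0 \<le> q\<close> \<open>q < 1\<close> by auto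
    fix x y
    define d G where "d = x - y" and "G = g x - g y"
    have "2 * u / (L + \<mu>) * ((norm G)\<^sup>2 + \<mu> * L * (norm d)\<^sup>2) \<le> 2 * u / (L + \<mu>) * ((L + \<mu>) * (G \<bullet> d))"
      using coerc[of x y] u \<open>0 < L + \<mu>\<close> unfolding d_def G_def by (intro mult_left_mono) auto
    also have "\<dots> = 2 * u * (G \<bullet> d)" using \<open>0 < L + \<mu>\<close> by simp
    finally have 1: "u * (2 / (L + \<mu>)) * (norm G)\<^sup>2 + (1 - q) * (norm d)\<^sup>2 \<le> 2 * u * (G \<bullet> d)"
      by (simp add: q_def algebra_simps)
    have 2: "u * u * (norm G)\<^sup>2 \<le> u * (2 / (L + \<mu>)) * (norm G)\<^sup>2"
      using u by (intro mult_right_mono mult_left_mono) auto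
    have "(norm (d - u *\<^sub>R G))\<^sup>2 = (norm d)\<^sup>2 - 2 * u * (G \<bullet> d) + u * u * (norm G)\<^sup>2"
      unfolding power2_norm_eq_inner by (simp add: inner_simps inner_commute)
    also have "\<dots> \<le> q * (norm d)\<^sup>2"
      using 1 2 by (simp add: left_diff_distrib)
    finally have "(norm (d - u *\<^sub>R G))\<^sup>2 \<le> (sqrt q * norm d)\<^sup>2"
      using \<open>0 \<le> q\<close> by (simp add: power_mult_distrib)
    then have "norm (d - u *\<^sub>R G) \<le> sqrt q * norm d"
      by (rule power2_le_imp_le) (use \<open>0 \<le> q\<close> in simp)
    then show "norm ((x - u *\<^sub>R g x) - (y - u *\<^sub>R g y)) \<le> sqrt q * norm (x - y)"
      by (simp add: d_def G_def algebra_simps)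
  qed
qed

section \<open>Proximal maps\<close>

text \<open>A real \<open>c\<close> strictly between the height of a point below the graph and the
  value of \<open>g\<close> gives the open box \<open>U \<times> {..<c}\<close>, which stays below
  the graph. So the complement of the epigraph is open.\<close>

lemma lsc_fun_epigraph_closed:
  fixes g :: "'a::real_normed_vector \<Rightarrow> ereal"
  assumes "lsc_fun g"
  shows "closed {p. g (fst p) \<le> ereal (snd p)}"
proof -
  have "open {p. ereal (snd p) < g (fst p)}"
  proof (subst open_subopen, intro ballI)
    fix p assume "p \<in> {p. ereal (snd p) < g (fst p)}"
    then have "ereal (snd p) < g (fst p)" by simp
    then obtain c where c: "ereal (snd p) < ereal c" "ereal c < g (fst p)"
      using ereal_dense2 by blast
    have "ereal c < Liminf (at (fst p)) g"
      using c(2) assms by (auto simp: lsc_fun_def intro: less_le_trans)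
    then have "\<forall>\<^sub>F x in at (fst p). ereal c < g x" by (rule less_LiminfD)
    \<comment> \<open>\<open>lsc_fun\<close> speaks of punctured neighbourhoods; the centre is added
      by \<open>c(2)\<close>.\<close>
    then have "\<forall>\<^sub>F x in nhds (fst p). ereal c < g x"
      using c(2) by (auto simp: eventually_at_filter elim!: eventually_mono)
    then obtain U where U: "open U" "fst p \<in> U" "\<And>x. x \<in> U \<Longrightarrow> ereal c < g x"
      by (auto simp: eventually_nhds)
    show "\<exists>V. open V \<and> p \<in> V \<and> V \<subseteq> {p. ereal (snd p) < g (fst p)}"
    proof (intro exI conjI)
      show "open (U \<times> {..<c})" using U(1) by (intro open_Times) auto
      show "p \<in> U \<times> {..<c}" using U(2) c(1) by (cases p) auto
      show "U \<times> {..<c} \<subseteq> {p. ereal (snd p) < g (fst p)}"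
        using U(3) by (auto intro: less_trans[of _ "ereal c"])
    qed
  qed
  moreover have "- {p. ereal (snd p) < g (fst p)} = {p. g (fst p) \<le> ereal (snd p)}" by auto
  ultimately show ?thesis by (metis closed_Compl)
qed

text \<open>Lower semicontinuity bounds \<open>g\<close> from below near a point of its domain, and convexity along
  rays propagates this to a linear bound; no separating hyperplane is needed.\<close>

lemma convex_lsc_linear_lower_bound:
  fixes g :: "'a::real_normed_vector \<Rightarrow> ereal"
  assumes lsc: "lsc_fun g" and conv: "ereal_convex g"
    and g0: "g v0 = ereal c0"
  obtains b where "0 < b" "\<And>v. ereal (c0 - 1 - b * norm (v - v0)) \<le> g v"
proof -
  have "ereal (c0 - 1) < ereal c0" by simp
  also have "\<dots> \<le> Liminf (at v0) g" using lsc by (simp add: lsc_fun_def flip: g0)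
  finally have "ereal (c0 - 1) < Liminf (at v0) g" .
  then have "\<forall>\<^sub>F x in at v0. ereal (c0 - 1) < g x" by (rule less_LiminfD)
  then obtain \<delta> where \<delta>: "0 < \<delta>" "\<And>v. v \<noteq> v0 \<Longrightarrow> dist v v0 < \<delta> \<Longrightarrow> ereal (c0 - 1) < g v"
    by (auto simp: eventually_at)
  have near: "ereal (c0 - 1) < g v" if "norm (v - v0) < \<delta>" for v
    using \<delta>(2)[of v] that g0 by (cases "v = v0") (auto simp: dist_norm)
  \<comment> \<open>With this slope, the point at parameter \<open>\<theta> = 1 / (b * n)\<close> on
    the segment from \<open>v0\<close> to \<open>v\<close> has distance \<open>\<delta> / 2\<close>
    from \<open>v0\<close>, so the local bound applies there. Solving the convexity inequality for
    \<open>g v\<close> then costs \<open>1 / \<theta> = b * n\<close>.\<close>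
  define b where "b = 2 / \<delta>"
  have "0 < b" using \<delta>(1) by (simp add: b_def)
  have "ereal (c0 - 1 - b * norm (v - v0)) \<le> g v" for v
  proof (cases "norm (v - v0) < \<delta>")
    case True
    have "ereal (c0 - 1 - b * norm (v - v0)) \<le> ereal (c0 - 1)"
      using \<open>0 < b\<close> by simp
    then show ?thesis using near[OF True] by (meson le_less_trans less_imp_le)
  next
    case False
    define n where "n = norm (v - v0)"
    define \<theta> where "\<theta> = 1 / (b * n)"
    have n: "n \<ge> \<delta>" "n > 0" using False \<delta>(1) by (auto simp: n_def)
    then have \<theta>: "0 < \<theta>" "\<theta> \<le> 1" using \<delta>(1) by (auto simp: \<theta>_def b_def)
    have "norm (((1 - \<theta>) *\<^sub>R v0 + \<theta> *\<^sub>R v) - v0) = norm (\<theta> *\<^sub>R (v - v0))"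
      by (simp add: algebra_simps)
    also have "\<dots> = \<delta> / 2" using \<theta> n \<delta>(1) by (simp add: \<theta>_def b_def n_def[symmetric])
    finally have "ereal (c0 - 1) < g ((1 - \<theta>) *\<^sub>R v0 + \<theta> *\<^sub>R v)"
      using \<delta>(1) by (intro near) simp
    also have "\<dots> \<le> ereal (1 - \<theta>) * g v0 + ereal \<theta> * g v"
      using conv \<theta> by (simp add: ereal_convex_def)
    finally have *: "ereal (c0 - 1) < ereal ((1 - \<theta>) * c0) + ereal \<theta> * g v"
      by (simp add: g0)
    show ?thesis
    proof (cases "g v")
      case (real r)
      with * have "c0 - 1 < (1 - \<theta>) * c0 + \<theta> * r" by simp
      then have "\<theta> * (c0 - 1 / \<theta>) < \<theta> * r" using \<theta> by (simp add: algebra_simps)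
      then have "c0 - 1 / \<theta> < r" using \<theta> by simp
      moreover have "1 / \<theta> = b * n" by (simp add: \<theta>_def)
      ultimately show ?thesis using real by (simp add: n_def)
    next
      case MInf
      with * \<theta> show ?thesis by simp
    qed simp
  qed
  with \<open>0 < b\<close> show thesis by (rule that)
qed

lemma proper_funE:
  assumes "proper_fun g"
  obtains v0 c0 where "g v0 = ereal c0"
  using assms unfolding proper_fun_def by (metis ereal_cases)

text \<open>The quadratic term outgrows the linear lower bound of \<open>g\<close>, so a sublevel
  set of the objective over the epigraph is compact and the minimum is attained.\<close>

lemma prox_minimizer_exists:
  fixes g :: "'a::euclidean_space \<Rightarrow> ereal"
  assumes proper: "proper_fun g" and lsc: "lsc_fun g" and conv: "ereal_convex g"
  shows "\<exists>p. \<forall>v. g p + ereal (1/2 * (norm (p - x))\<^sup>2) \<le> g v + ereal (1/2 * (norm (v - x))\<^sup>2)"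
proof -
  obtain v0 c0 where g0: "g v0 = ereal c0" using proper by (rule proper_funE)
  obtain b where b: "0 < b" "\<And>v. ereal (c0 - 1 - b * norm (v - v0)) \<le> g v"
    using convex_lsc_linear_lower_bound[OF lsc conv g0] by blast
  \<comment> \<open>Minimising over the epigraph replaces the extended-valued objective by a continuous real one.\<close>
  define J where "J = (\<lambda>p::'a \<times> real. snd p + 1/2 * (norm (fst p - x))\<^sup>2)"
  define E where "E = {p. g (fst p) \<le> ereal (snd p)} \<inter> {p. J p \<le> J (v0, c0)}"
  have contJ: "continuous_on A J" for A
    unfolding J_def by (intro continuous_intros)
  have "closed E"
    unfolding E_def
    by (intro closed_Int lsc_fun_epigraph_closed lsc closed_Collect_le contJ continuous_intros)
  moreover have "bounded E"
  proof -
    define D where "D = norm (v0 - x)"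
    \<comment> \<open>The bound \<open>q\<close> below is quadratic in \<open>n\<close>. For
      \<open>n > 1\<close> its constants can be multiplied by \<open>n\<close>, which turns it into
      \<open>n * n \<le> R * n\<close>.\<close>
    define R where "R = 1 + 2 * b + 1 + 2 * b * D + D\<^sup>2"
    have "norm (fst p - x) \<le> R \<and> \<bar>snd p\<bar> \<le> \<bar>c0\<bar> + 1 + b * (R + D) + D\<^sup>2" if "p \<in> E" for p
    proof -
      define n where "n = norm (fst p - x)"
      have "n \<ge> 0" "D \<ge> 0" by (auto simp: n_def D_def)
      have J: "snd p + 1/2 * n\<^sup>2 \<le> c0 + 1/2 * D\<^sup>2" and epi: "g (fst p) \<le> ereal (snd p)"
        using that by (auto simp: E_def J_def n_def D_def)
      have "norm (fst p - v0) \<le> n + D"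
        unfolding n_def D_def using norm_triangle_ineq4[of "fst p - x" "v0 - x"] by simp
      then have "b * norm (fst p - v0) \<le> b * (n + D)" using b(1) by simp
      moreover have "c0 - 1 - b * norm (fst p - v0) \<le> snd p"
        using order_trans[OF b(2) epi] by simp
      ultimately have low: "c0 - 1 - b * (n + D) \<le> snd p" by linarith
      have "n \<le> R"
      proof (rule ccontr)
        assume "\<not> n \<le> R"
        then have "R < n" by simp
        have q: "n * n \<le> 2 + 2 * b * n + (2 * b * D + D\<^sup>2)"
          using J low by (simp add: power2_eq_square algebra_simps)
        have "1 \<le> R" using b(1) \<open>D \<ge> 0\<close> by (simp add: R_def)
        then have "1 < n" using \<open>R < n\<close> by simp
        then have "2 + (2 * b * D + D\<^sup>2) \<le> (2 + (2 * b * D + D\<^sup>2)) * n"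
          using mult_left_mono[of 1 n "2 + (2 * b * D + D\<^sup>2)"] b(1) \<open>D \<ge> 0\<close> by simp
        with q have "n * n \<le> R * n" by (simp add: R_def algebra_simps)
        with \<open>1 < n\<close> \<open>R < n\<close> show False by simp
      qed
      moreover from this have "b * (n + D) \<le> b * (R + D)" using b(1) by simp
      moreover have "0 \<le> b * (R + D)"
        using b(1) \<open>D \<ge> 0\<close> \<open>n \<ge> 0\<close> \<open>n \<le> R\<close> by simp
      ultimately show ?thesis
        using J low zero_le_power2[of n] zero_le_power2[of D] unfolding n_def[symmetric] by linarith
    qed
    then have "E \<subseteq> cball x R \<times> cball 0 (\<bar>c0\<bar> + 1 + b * (R + D) + D\<^sup>2)"
      by (force simp: dist_norm norm_minus_commute)
    then show ?thesis
      by (rule bounded_subset[rotated]) (intro bounded_Times bounded_cball)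
  qed
  ultimately have "compact E" by (simp add: compact_eq_bounded_closed)
  moreover have "(v0, c0) \<in> E" by (simp add: E_def g0)
  ultimately obtain p where p: "p \<in> E" "\<And>q. q \<in> E \<Longrightarrow> J p \<le> J q"
    using continuous_attains_inf[of E J] contJ by blast
  have "g (fst p) + ereal (1/2 * (norm (fst p - x))\<^sup>2) \<le> g v + ereal (1/2 * (norm (v - x))\<^sup>2)" for v
  proof (cases "g v")
    case (real r)
    \<comment> \<open>Epigraph points outside \<open>E\<close> have a larger objective than
      \<open>(v0, c0)\<close>, hence than \<open>p\<close>.\<close>
    have "J p \<le> J (v, r)"
    proof (cases "(v, r) \<in> E")
      case False
      then have "J (v0, c0) < J (v, r)" using real by (auto simp: E_def)
      then show ?thesis using p(1) by (auto simp: E_def)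
    qed (rule p(2))
    then have "ereal (snd p) + ereal (1/2 * (norm (fst p - x))\<^sup>2) \<le> g v + ereal (1/2 * (norm (v - x))\<^sup>2)"
      by (simp add: real J_def)
    moreover have "g (fst p) \<le> ereal (snd p)" using p(1) by (simp add: E_def)
    ultimately show ?thesis by (meson add_right_mono order_trans)
  next
    case MInf
    then show ?thesis using proper by (simp add: proper_fun_def)
  qed simp
  then show ?thesis by blast
qed

text \<open>The minimiser is compared with points on the segment from \<open>p\<close> to
  \<open>v\<close>; dividing by \<theta> and letting it tend to 0 removes the quadratic remainder.
  The conclusion says that \<open>x - p\<close> is a subgradient of \<open>g\<close> at
  \<open>p\<close>.\<close>

lemma prox_minimizer_variational:
  fixes g :: "'a::real_inner \<Rightarrow> ereal"
  assumes proper: "proper_fun g" and conv: "ereal_convex g"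
    and min: "\<And>v. g p + ereal (1/2 * (norm (p - x))\<^sup>2) \<le> g v + ereal (1/2 * (norm (v - x))\<^sup>2)"
  obtains a where "g p = ereal a" "\<And>v c. g v = ereal c \<Longrightarrow> a + (x - p) \<bullet> (v - p) \<le> c"
proof -
  obtain v0 c0 where g0: "g v0 = ereal c0" using proper by (rule proper_funE)
  obtain a where a: "g p = ereal a"
    using min[of v0] proper by (cases "g p") (auto simp: g0 proper_fun_def)
  have "a + (x - p) \<bullet> (v - p) \<le> c" if c: "g v = ereal c" for v c
  proof -
    have "\<forall>\<^sub>F \<theta> in at_right 0. a + (x - p) \<bullet> (v - p) \<le> c + \<theta> / 2 * (norm (v - p))\<^sup>2"
      using eventually_at_right_real[of 0 "1::real", OF zero_less_one]
    proof eventually_elim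
      case (elim \<theta>)
      then have \<theta>: "0 < \<theta>" "\<theta> \<le> 1" by auto
      define z where "z = (1 - \<theta>) *\<^sub>R p + \<theta> *\<^sub>R v"
      have "g z \<le> ereal ((1 - \<theta>) * a + \<theta> * c)"
        using conv[unfolded ereal_convex_def, rule_format, of \<theta> p v] \<theta>
        by (simp add: z_def a c)
      then have "g z + ereal (1/2 * (norm (z - x))\<^sup>2)
          \<le> ereal ((1 - \<theta>) * a + \<theta> * c) + ereal (1/2 * (norm (z - x))\<^sup>2)"
        by (rule add_right_mono)
      from order_trans[OF min[of z] this] have 1: "a + 1/2 * (norm (p - x))\<^sup>2 \<le> (1 - \<theta>) * a + \<theta> * c + 1/2 * (norm (z - x))\<^sup>2"
        by (simp add: a)
      have zx: "z - x = (p - x) + \<theta> *\<^sub>R (v - p)" by (simp add: z_def algebra_simps)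
      have "(norm (z - x))\<^sup>2 = (norm (p - x))\<^sup>2 - 2 * \<theta> * ((x - p) \<bullet> (v - p)) + \<theta>\<^sup>2 * (norm (v - p))\<^sup>2"
        unfolding zx power2_norm_eq_inner
        by (simp add: inner_simps inner_commute power2_eq_square algebra_simps)
      with 1 have "\<theta> * (a + (x - p) \<bullet> (v - p)) \<le> \<theta> * (c + \<theta> / 2 * (norm (v - p))\<^sup>2)"
        by (simp add: algebra_simps power2_eq_square)
      then show ?case using \<theta> by simp
    qed
    moreover have "((\<lambda>\<theta>. c + \<theta> / 2 * (norm (v - p))\<^sup>2) \<longlongrightarrow> c + 0 / 2 * (norm (v - p))\<^sup>2) (at_right 0)"
      by (intro tendsto_intros) auto
    ultimately have "a + (x - p) \<bullet> (v - p) \<le> c + 0 / 2 * (norm (v - p))\<^sup>2"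
      by (intro tendsto_lowerbound) auto
    then show ?thesis by simp
  qed
  with a show thesis by (rule that)
qed

text \<open>The sum of the two subgradient inequalities gives firm nonexpansiveness, and
  Cauchy-Schwarz finishes. Arbitrary minimisers are used instead of \<open>prox\<close>, so that the
  case \<open>x = y\<close> provides the uniqueness behind its \<open>THE\<close>.\<close>

lemma prox_minimizers_nonexpansive:
  fixes g :: "'a::real_inner \<Rightarrow> ereal"
  assumes "proper_fun g" "ereal_convex g"
    and p: "\<And>v. g p + ereal (1/2 * (norm (p - x))\<^sup>2) \<le> g v + ereal (1/2 * (norm (v - x))\<^sup>2)"
    and q: "\<And>v. g q + ereal (1/2 * (norm (q - y))\<^sup>2) \<le> g v + ereal (1/2 * (norm (v - y))\<^sup>2)"
  shows "norm (p - q) \<le> norm (x - y)"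
proof -
  obtain a where a: "g p = ereal a" "\<And>v c. g v = ereal c \<Longrightarrow> a + (x - p) \<bullet> (v - p) \<le> c"
    using prox_minimizer_variational[OF assms(1,2) p] by blast
  obtain b where b: "g q = ereal b" "\<And>v c. g v = ereal c \<Longrightarrow> b + (y - q) \<bullet> (v - q) \<le> c"
    using prox_minimizer_variational[OF assms(1,2) q] by blast
  have "(norm (p - q))\<^sup>2 \<le> (x - y) \<bullet> (p - q)"
    using a(2)[OF b(1)] b(2)[OF a(1)] unfolding power2_norm_eq_inner
    by (simp add: inner_simps inner_commute algebra_simps)
  also have "\<dots> \<le> norm (x - y) * norm (p - q)" by (rule norm_cauchy_schwarz)
  finally show ?thesis
    by (cases "p = q") (auto simp: power2_eq_square)
qed

lemma prox_nonexpansive: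
  fixes g :: "'a::euclidean_space \<Rightarrow> ereal"
  assumes "proper_fun g" "lsc_fun g" "ereal_convex g"
  shows "norm (prox g x - prox g y) \<le> norm (x - y)"
proof -
  have "\<forall>v. g (prox g x) + ereal (1/2 * (norm (prox g x - x))\<^sup>2) \<le> g v + ereal (1/2 * (norm (v - x))\<^sup>2)" for x
    unfolding prox_def
  proof (rule theI')
    show "\<exists>!p. \<forall>v. g p + ereal (1/2 * (norm (p - x))\<^sup>2) \<le> g v + ereal (1/2 * (norm (v - x))\<^sup>2)"
    proof (rule ex_ex1I[OF prox_minimizer_exists[OF assms]])
      fix p q
      assume "\<forall>v. g p + ereal (1/2 * (norm (p - x))\<^sup>2) \<le> g v + ereal (1/2 * (norm (v - x))\<^sup>2)"
        and "\<forall>v. g q + ereal (1/2 * (norm (q - x))\<^sup>2) \<le> g v + ereal (1/2 * (norm (v - x))\<^sup>2)"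
      then show "p = q"
        using prox_minimizers_nonexpansive[OF assms(1,3), of p x q x] by simp
    qed
  qed
  then show ?thesis
    using prox_minimizers_nonexpansive[OF assms(1,3)] by blast
qed

lemma proper_fun_scale:
  assumes "0 < t" "proper_fun g"
  shows "proper_fun (\<lambda>v. ereal t * g v)"
  using assms by (auto simp: proper_fun_def)

lemma lsc_fun_scale:
  fixes g :: "'a::euclidean_space \<Rightarrow> ereal"
  assumes "0 < t" "lsc_fun g"
  shows "lsc_fun (\<lambda>v. ereal t * g v)"
  using assms by (auto simp: lsc_fun_def Liminf_ereal_mult_left intro: ereal_mult_left_mono)

lemma ereal_convex_scale:
  assumes "0 < t" "ereal_convex g"
  shows "ereal_convex (\<lambda>v. ereal t * g v)"
  unfolding ereal_convex_def
proof (intro allI impI)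
  fix x y and \<theta> :: real assume \<theta>: "0 \<le> \<theta> \<and> \<theta> \<le> 1"
  have "ereal t * g ((1 - \<theta>) *\<^sub>R x + \<theta> *\<^sub>R y) \<le> ereal t * (ereal (1 - \<theta>) * g x + ereal \<theta> * g y)"
    using assms \<theta> by (intro ereal_mult_left_mono) (auto simp: ereal_convex_def)
  also have "\<dots> = ereal (1 - \<theta>) * (ereal t * g x) + ereal \<theta> * (ereal t * g y)"
    using assms(1) by (simp add: ereal_pos_distrib mult.left_commute)
  finally show "ereal t * g ((1 - \<theta>) *\<^sub>R x + \<theta> *\<^sub>R y)
      \<le> ereal (1 - \<theta>) * (ereal t * g x) + ereal \<theta> * (ereal t * g y)" .
qed

lemma forward_backward_nonexpansive:
  fixes f :: "'a::euclidean_space \<Rightarrow> real"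
  assumes g: "proper_fun g" "lsc_fun g" "ereal_convex g"
    and f: "convex_on UNIV f" "\<And>z. (f has_derivative (\<lambda>h. gf z \<bullet> h)) (at z)"
      "\<And>y z. norm (gf y - gf z) \<le> L * norm (y - z)"
    and L: "0 < L" and t: "0 < t" "t \<le> 1 / L"
  shows "norm (prox (\<lambda>v. ereal t * g v) (y - t *\<^sub>R gf y) - prox (\<lambda>v. ereal t * g v) (z - t *\<^sub>R gf z))
    \<le> norm (y - z)"
proof -
  have "t \<le> 2 / L" using t(2) L by (simp add: field_simps)
  have "norm (prox (\<lambda>v. ereal t * g v) (y - t *\<^sub>R gf y) - prox (\<lambda>v. ereal t * g v) (z - t *\<^sub>R gf z))
      \<le> norm ((y - t *\<^sub>R gf y) - (z - t *\<^sub>R gf z))"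
    using proper_fun_scale lsc_fun_scale ereal_convex_scale g t(1) by (intro prox_nonexpansive) auto
  also have "\<dots> \<le> norm (y - z)"
    using gradient_step_nonexpansive[OF f L _ \<open>t \<le> 2 / L\<close>] t(1) by simp
  finally show ?thesis .
qed

section \<open>Monotone variational inequalities\<close>

lemma nonexpansive_complement_monotone:
  fixes T :: "'a::real_inner \<Rightarrow> 'a"
  assumes "norm (T x - T y) \<le> norm (x - y)"
  shows "0 \<le> ((x - T x) - (y - T y)) \<bullet> (x - y)"
proof -
  have "(T x - T y) \<bullet> (x - y) \<le> norm (T x - T y) * norm (x - y)" by (rule norm_cauchy_schwarz)
  also have "\<dots> \<le> norm (x - y) * norm (x - y)" using assms by (rule mult_right_mono) simp
  also have "\<dots> = (x - y) \<bullet> (x - y)" by (simp add: power2_norm_eq_inner flip: power2_eq_square)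
  finally show ?thesis by (simp add: inner_simps)
qed

lemma nonexpansive_imp_continuous_on:
  fixes T :: "'a::real_normed_vector \<Rightarrow> 'b::real_normed_vector"
  assumes "\<And>x y. norm (T x - T y) \<le> norm (x - y)"
  shows "continuous_on A T"
proof (rule lipschitz_on_continuous_on)
  show "1-lipschitz_on A T"
    using assms by (intro lipschitz_onI) (auto simp: dist_norm)
qed

text \<open>One inclusion is monotonicity. For the other, test at
  \<open>x + \<theta> *\<^sub>R (y - x)\<close>, cancel \<theta> and let it tend to 0, using
  continuity of \<open>A\<close>. In the second form the operator is evaluated at \<open>y\<close>
  alone, so each condition on \<open>x\<close> is linear.\<close>

lemma variational_inequality_Minty:
  fixes A :: "'a::real_inner \<Rightarrow> 'a"
  assumes "convex C" and cont: "continuous_on UNIV A"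
    and mono: "\<And>x y. 0 \<le> (A x - A y) \<bullet> (x - y)"
  shows "{x \<in> C. \<forall>y\<in>C. 0 \<le> A x \<bullet> (y - x)} = {x \<in> C. \<forall>y\<in>C. 0 \<le> A y \<bullet> (y - x)}"
proof (intro Collect_cong conj_cong refl iffI ballI)
  fix x y assume "\<forall>y\<in>C. 0 \<le> A x \<bullet> (y - x)" "y \<in> C"
  then show "0 \<le> A y \<bullet> (y - x)" using mono[of y x] by (force simp: inner_diff_left)
next
  fix x y assume x: "x \<in> C" and minty: "\<forall>y\<in>C. 0 \<le> A y \<bullet> (y - x)" and y: "y \<in> C"
  have "\<forall>\<^sub>F \<theta> in at_right 0. 0 \<le> A (x + \<theta> *\<^sub>R (y - x)) \<bullet> (y - x)"
    using eventually_at_right_real[of 0 "1::real", OF zero_less_one]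
  proof eventually_elim
    case (elim \<theta>)
    then have "(1 - \<theta>) *\<^sub>R x + \<theta> *\<^sub>R y \<in> C"
      using \<open>convex C\<close> x y by (intro convexD) auto
    then have "x + \<theta> *\<^sub>R (y - x) \<in> C" by (simp add: algebra_simps)
    with minty have "0 \<le> A (x + \<theta> *\<^sub>R (y - x)) \<bullet> (\<theta> *\<^sub>R (y - x))" by fastforce
    then show ?case using elim by (simp add: zero_le_mult_iff)
  qed
  moreover have "isCont A z" for z using cont by (simp add: continuous_on_eq_continuous_at)
  then have "((\<lambda>\<theta>. A (x + \<theta> *\<^sub>R (y - x)) \<bullet> (y - x)) \<longlongrightarrow> A (x + 0 *\<^sub>R (y - x)) \<bullet> (y - x)) (at_right 0)"
    by (intro tendsto_intros isCont_tendsto_compose[where g = A]) auto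
  ultimately have "0 \<le> A (x + 0 *\<^sub>R (y - x)) \<bullet> (y - x)"
    by (intro tendsto_lowerbound) auto
  then show "0 \<le> A x \<bullet> (y - x)" by simp
qed

text \<open>In Minty's form the solution set is the intersection of \<open>C\<close> with closed
  half-spaces.\<close>

lemma variational_inequality_solutions_closed_convex:
  fixes A :: "'a::real_inner \<Rightarrow> 'a"
  assumes "convex C" "closed C" "continuous_on UNIV A"
    and "\<And>x y. 0 \<le> (A x - A y) \<bullet> (x - y)"
  shows "closed {x \<in> C. \<forall>y\<in>C. 0 \<le> A x \<bullet> (y - x)}"
    and "convex {x \<in> C. \<forall>y\<in>C. 0 \<le> A x \<bullet> (y - x)}"
proof -
  have eq: "{x \<in> C. \<forall>y\<in>C. 0 \<le> A x \<bullet> (y - x)} = C \<inter> (\<Inter>y\<in>C. {x. A y \<bullet> x \<le> A y \<bullet> y})"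
    unfolding variational_inequality_Minty[OF assms(1,3,4)] by (auto simp: inner_diff_right)
  show "closed {x \<in> C. \<forall>y\<in>C. 0 \<le> A x \<bullet> (y - x)}"
    unfolding eq using \<open>closed C\<close> by (intro closed_Int closed_INT ballI closed_halfspace_le) auto
  show "convex {x \<in> C. \<forall>y\<in>C. 0 \<le> A x \<bullet> (y - x)}"
    unfolding eq using \<open>convex C\<close> by (intro convex_Int convex_INT convex_halfspace_le) auto
qed

text \<open>The test point \<open>W x\<close> forces \<open>x - W x\<close> to vanish. This puts
  \<open>Fix W\<close> under the same closedness and convexity result as \<Omega>.\<close>

lemma Fix_eq_variational_inequality:
  fixes W :: "'a::real_inner \<Rightarrow> 'a"
  shows "Fix W = {x \<in> UNIV. \<forall>y\<in>UNIV. 0 \<le> (x - W x) \<bullet> (y - x)}"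
proof -
  have "W x = x" if "\<forall>y. 0 \<le> (x - W x) \<bullet> (y - x)" for x
  proof -
    have "0 \<le> - ((x - W x) \<bullet> (x - W x))"
      using that[rule_format, of "W x"] by (simp add: inner_diff_right)
    then have "(x - W x) \<bullet> (x - W x) = 0"
      using inner_ge_zero[of "x - W x"] by linarith
    then show ?thesis by simp
  qed
  then show ?thesis by (auto simp: Fix_def)
qed

lemma Fix_nonexpansive_closed_convex:
  fixes W :: "'a::real_inner \<Rightarrow> 'a"
  assumes "\<And>x y. norm (W x - W y) \<le> norm (x - y)"
  shows "closed (Fix W)" "convex (Fix W)"
proof -
  have "0 \<le> ((x - W x) - (y - W y)) \<bullet> (x - y)" for x y
    by (rule nonexpansive_complement_monotone[OF assms])
  moreover have "continuous_on UNIV (\<lambda>x. x - W x)"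
    using nonexpansive_imp_continuous_on[OF assms] by (intro continuous_intros)
  ultimately show "closed (Fix W)" "convex (Fix W)"
    unfolding Fix_eq_variational_inequality
    using variational_inequality_solutions_closed_convex[of UNIV "\<lambda>x. x - W x"] by auto
qed

text \<open>Projection onto \<open>C\<close> after \<open>S\<close> is a contraction, and the
  obtuse-angle property of the projection turns its Banach fixed point into a solution. For two
  solutions, adding the inequalities tested against each other contradicts \<open>r < 1\<close>
  unless they coincide.\<close>

lemma contraction_variational_inequality_unique:
  fixes S :: "'a::euclidean_space \<Rightarrow> 'a"
  assumes C: "closed C" "convex C" "C \<noteq> {}"
    and r: "0 \<le> r" "r < 1" and S: "\<And>x y. norm (S x - S y) \<le> r * norm (x - y)"
  shows "\<exists>!p. p \<in> C \<and> (\<forall>z\<in>C. 0 \<le> (p - S p) \<bullet> (z - p))"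
proof (rule ex_ex1I)
  have "dist (closest_point C (S x)) (closest_point C (S y)) \<le> r * dist x y" for x y
    using closest_point_lipschitz[OF C(2,1,3), of "S x" "S y"] S[of x y] by (simp add: dist_norm)
  then obtain p where p: "closest_point C (S p) = p"
    using banach_fix_type[OF r, of "\<lambda>x. closest_point C (S x)"] by blast
  have "p \<in> C" using closest_point_in_set[OF C(1,3)] p by metis
  moreover have "0 \<le> (p - S p) \<bullet> (z - p)" if "z \<in> C" for z
    using closest_point_dot[OF C(2,1) that, of "S p"] by (simp add: p inner_diff_left)
  ultimately show "\<exists>p. p \<in> C \<and> (\<forall>z\<in>C. 0 \<le> (p - S p) \<bullet> (z - p))" by blast
next
  fix p q
  assume p: "p \<in> C \<and> (\<forall>z\<in>C. 0 \<le> (p - S p) \<bullet> (z - p))"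
    and q: "q \<in> C \<and> (\<forall>z\<in>C. 0 \<le> (q - S q) \<bullet> (z - q))"
  have "0 \<le> (p - S p) \<bullet> (q - p) + (q - S q) \<bullet> (p - q)"
    using p q by (intro add_nonneg_nonneg) auto
  then have "norm (p - q) * norm (p - q) \<le> (S p - S q) \<bullet> (p - q)"
    by (simp add: inner_simps inner_commute power2_norm_eq_inner flip: power2_eq_square)
  also have "\<dots> \<le> norm (S p - S q) * norm (p - q)" by (rule norm_cauchy_schwarz)
  also have "\<dots> \<le> (r * norm (p - q)) * norm (p - q)" using S by (rule mult_right_mono) simp
  finally have "(1 - r) * (norm (p - q) * norm (p - q)) \<le> 0" by (simp add: algebra_simps)
  then show "p = q" using r by (simp add: mult_le_0_iff)
qed

section \<open>Convergence of the iteration\<close>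

text \<open>Otherwise infinitely many terms satisfy \<open>e < \<phi> (x k)\<close>, and by
  boundedness some of them converge to a limit point where \<phi> is at least
  \<open>e\<close>.\<close>

lemma eventually_le_if_limit_points_nonpos:
  fixes x :: "nat \<Rightarrow> 'a::heine_borel" and \<phi> :: "'a \<Rightarrow> real"
  assumes "bounded (range x)" and cont: "continuous_on UNIV \<phi>"
    and lim: "\<And>l r. strict_mono r \<Longrightarrow> (x \<circ> r) \<longlonglongrightarrow> l \<Longrightarrow> \<phi> l \<le> 0"
    and "0 < e"
  shows "\<forall>\<^sub>F k in sequentially. \<phi> (x k) \<le> e"
proof (rule ccontr)
  assume "\<not> ?thesis"
  then have "\<exists>\<^sub>F k in sequentially. e < \<phi> (x k)"
    by (simp add: not_eventually not_le)
  then have "infinite {k. e < \<phi> (x k)}"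
    by (simp add: INFM_iff_infinite flip: cofinite_eq_sequentially)
  then obtain q :: "nat \<Rightarrow> nat" where q: "strict_mono q" "\<And>n. e < \<phi> (x (q n))"
    using infinite_enumerate by blast
  have "bounded (range (x \<circ> q))" by (rule bounded_subset[OF assms(1)]) auto
  then obtain l s where s: "strict_mono s" "((x \<circ> q) \<circ> s) \<longlonglongrightarrow> l"
    using bounded_imp_convergent_subsequence by blast
  have "\<phi> l \<le> 0" using lim[of "q \<circ> s" l] s strict_mono_o[OF q(1) s(1)] by (simp add: o_assoc)
  moreover have "(\<lambda>n. \<phi> (((x \<circ> q) \<circ> s) n)) \<longlonglongrightarrow> \<phi> l"
    using cont by (intro isCont_tendsto_compose[OF _ s(2)]) (simp add: continuous_on_eq_continuous_at)
  then have "e \<le> \<phi> l"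
    by (rule tendsto_lowerbound) (auto intro!: always_eventually less_imp_le q(2))
  ultimately show False using \<open>0 < e\<close> by simp
qed

lemma limsup_ereal_0_imp_tendsto_0:
  fixes f :: "nat \<Rightarrow> real"
  assumes "limsup (\<lambda>k. ereal (f k)) = 0" "\<And>k. 0 \<le> f k"
  shows "f \<longlonglongrightarrow> 0"
proof (rule tendstoI)
  fix e :: real assume "0 < e"
  then have "\<forall>\<^sub>F k in sequentially. ereal (f k) < ereal e"
    using assms(1) by (intro Limsup_lessD) simp
  then show "\<forall>\<^sub>F k in sequentially. dist (f k) 0 < e"
    using assms(2) by simp
qed

lemma limsup_ereal_finite_imp_eventually_le:
  fixes f :: "nat \<Rightarrow> real"
  assumes "limsup (\<lambda>k. ereal (f k)) < \<infinity>"
  obtains B where "\<forall>\<^sub>F k in sequentially. f k \<le> B"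
proof -
  obtain c where c: "limsup (\<lambda>k. ereal (f k)) < ereal c"
    using assms ereal_dense2 by blast
  have "\<forall>\<^sub>F k in sequentially. f k \<le> c"
    using Limsup_lessD[OF c] by eventually_elim simp
  then show thesis by (rule that)
qed

lemma bounded_nonexpansive_image:
  fixes F :: "'a::real_normed_vector \<Rightarrow> 'b::real_normed_vector"
  assumes F: "\<And>x y. norm (F x - F y) \<le> norm (x - y)" and "bounded (range x)"
  obtains B where "0 < B" "\<And>k. norm (F (x k)) \<le> B"
proof -
  obtain b where b: "0 < b" "\<And>k. norm (x k) \<le> b"
    using assms(2) by (auto simp: bounded_pos)
  have "norm (F (x k)) \<le> b + norm (F 0)" for k
    using F[of "x k" 0] b(2)[of k] norm_triangle_ineq2[of "F (x k)" "F 0"] by simp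
  then show thesis by (intro that[of "b + norm (F 0)"]) (use b in \<open>auto intro: add_pos_nonneg\<close>)
qed

text \<open>Gradients and proximal maps enter only through the Lipschitz constants of
  \<open>S\<close>, \<open>T\<close> and \<open>W\<close>. The limsup conditions appear as limits
  and eventual bounds, and the solution \<open>xs\<close> is given in advance.\<close>

lemma trilevel_iteration_tendsto:
  fixes S T W :: "'a::euclidean_space \<Rightarrow> 'a" and x :: "nat \<Rightarrow> 'a"
  assumes r: "0 \<le> r" "r < 1" and S: "\<And>y z. norm (S y - S z) \<le> r * norm (y - z)"
    and T: "\<And>y z. norm (T y - T z) \<le> norm (y - z)"
    and W: "\<And>y z. norm (W y - W z) \<le> norm (y - z)"
    and \<alpha>: "\<And>k. 0 < \<alpha> k" "\<And>k. \<alpha> k < 1"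
    and \<beta>: "\<And>k. 0 < \<beta> k" "\<And>k. \<beta> k < 1"
    and iter: "\<And>k. x (Suc k) = \<alpha> k *\<^sub>R S (x k) + ((1 - \<alpha> k) * \<beta> k) *\<^sub>R T (x k)
                               + ((1 - \<alpha> k) * (1 - \<beta> k)) *\<^sub>R W (x k)"
    and \<Omega>_def: "\<Omega> = {z \<in> Fix W. \<forall>y\<in>Fix W. (z - T z) \<bullet> (y - z) \<ge> 0}"
    and xs: "xs \<in> \<Omega>" "\<And>z. z \<in> \<Omega> \<Longrightarrow> (xs - S xs) \<bullet> (z - xs) \<ge> 0"
    and ratio_inf: "filterlim (\<lambda>k. \<beta> k / \<alpha> k) at_top sequentially"
    and \<alpha>_zero: "\<alpha> \<longlonglongrightarrow> 0"
    and \<alpha>_sum: "filterlim (\<lambda>n. \<Sum>k<n. \<alpha> k) at_top sequentially"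
    and K_cond: "\<forall>\<^sub>F k in sequentially. 1 / \<alpha> (Suc k) * \<bar>1 / \<beta> (Suc k) - 1 / \<beta> k\<bar> \<le> K"
    and diff_cond: "(\<lambda>k. (\<bar>\<beta> (Suc k) - \<beta> k\<bar> + \<bar>\<alpha> (Suc k) - \<alpha> k\<bar>) / (\<alpha> (Suc k) * \<beta> (Suc k))) \<longlonglongrightarrow> 0"
    and x_bdd: "bounded (range x)"
    and A1: "(\<lambda>k. infdist (x (Suc k)) (Fix W) / \<beta> k) \<longlonglongrightarrow> 0"
    and A2: "\<forall>\<^sub>F k in sequentially. (\<beta> k)\<^sup>2 / \<alpha> k \<le> M"
  shows "x \<longlonglongrightarrow> xs"
proof -

  \<comment> \<open>Bounds along the orbit and divergence of the rates\<close>
  have S1: "norm (S y - S z) \<le> norm (y - z)" for y z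
    using S[of y z] mult_right_mono[of r 1 "norm (y - z)"] r by simp
  obtain BS where BS: "0 < BS" "\<And>k. norm (S (x k)) \<le> BS"
    using bounded_nonexpansive_image[OF S1 x_bdd] by blast
  obtain BT where BT: "0 < BT" "\<And>k. norm (T (x k)) \<le> BT"
    using bounded_nonexpansive_image[OF T x_bdd] by blast
  obtain BW where BW: "0 < BW" "\<And>k. norm (W (x k)) \<le> BW"
    using bounded_nonexpansive_image[OF W x_bdd] by blast
  define B where "B = BS + BT + BW"
  have "0 < B" using BS BT BW by (simp add: B_def)
  define D where "D = (\<lambda>k. \<bar>\<beta> (Suc k) - \<beta> k\<bar> + \<bar>\<alpha> (Suc k) - \<alpha> k\<bar>)"
  define z where "z = (\<lambda>k. norm (x (Suc k) - x k))"
  define \<gamma> where "\<gamma> = (\<lambda>k. (1 - r) * \<alpha> k)"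
  have \<gamma>: "0 < \<gamma> k" "\<gamma> k \<le> 1" for k
    using r \<alpha>[of k] mult_le_one[of "1 - r" "\<alpha> k"] by (auto simp: \<gamma>_def)
  have \<gamma>_sum: "filterlim (\<lambda>n. \<Sum>k<n. \<gamma> k) at_top sequentially"
    unfolding \<gamma>_def sum_distrib_left[symmetric]
    using r by (intro filterlim_tendsto_pos_mult_at_top[OF tendsto_const _ \<alpha>_sum]) simp
  \<comment> \<open>The recursion for \<open>z\<close> has rate \<open>\<gamma> (Suc k)\<close>, so
    divergence is needed for the shifted series.\<close>
  have "filterlim (\<lambda>n. - \<gamma> 0 + (\<Sum>k<Suc n. \<gamma> k)) at_top sequentially"
    by (intro filterlim_tendsto_add_at_top[OF tendsto_const] filterlim_compose[OF \<gamma>_sum filterlim_Suc])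
  then have \<gamma>_Suc_sum: "filterlim (\<lambda>n. \<Sum>k<n. \<gamma> (Suc k)) at_top sequentially"
    by (simp add: sum.lessThan_Suc_shift del: sum.lessThan_Suc)

  \<comment> \<open>Recursion for consecutive differences\<close>
  have step: "z (Suc k) \<le> (1 - \<gamma> (Suc k)) * z k + B * D k" for k
  proof -
    define a b a' b' where "a = \<alpha> k" and "b = \<beta> k" and "a' = \<alpha> (Suc k)" and "b' = \<beta> (Suc k)"
    define X X' where "X = x k" and "X' = x (Suc k)"
    have ab: "0 < a" "a < 1" "0 < b" "b < 1" "0 < a'" "a' < 1" "0 < b'" "b' < 1"
      using \<alpha> \<beta> by (auto simp: a_def b_def a'_def b'_def)
    \<comment> \<open>The values of the operators at \<open>X\<close>, weighted with the new
      coefficients, are added and subtracted: the first group varies the argument, the second the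
      coefficients.\<close>
    have "x (Suc (Suc k)) - x (Suc k) =
        (a' *\<^sub>R (S X' - S X) + ((1 - a') * b') *\<^sub>R (T X' - T X) + ((1 - a') * (1 - b')) *\<^sub>R (W X' - W X))
        + ((a' - a) *\<^sub>R S X + ((1 - a') * b' - (1 - a) * b) *\<^sub>R T X
           + ((1 - a') * (1 - b') - (1 - a) * (1 - b)) *\<^sub>R W X)"
      unfolding iter[of "Suc k"] unfolding X'_def[symmetric] unfolding X'_def iter[of k]
      by (simp add: X_def a_def b_def a'_def b'_def algebra_simps)
    then have "z (Suc k) \<le> (a' * norm (S X' - S X) + ((1 - a') * b') * norm (T X' - T X) + ((1 - a') * (1 - b')) * norm (W X' - W X))
        + (\<bar>a' - a\<bar> * norm (S X) + \<bar>(1 - a') * b' - (1 - a) * b\<bar> * norm (T X)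
           + \<bar>(1 - a') * (1 - b') - (1 - a) * (1 - b)\<bar> * norm (W X))"
      unfolding z_def using ab
      by (simp only:) (intro norm_add_rule_thm order_eq_refl, auto simp: abs_mult)
    also have "\<dots> \<le> (a' * (r * z k) + ((1 - a') * b') * z k + ((1 - a') * (1 - b')) * z k)
        + (D k * BS + D k * BT + D k * BW)"
    proof -
      \<comment> \<open>Differences of products are split as in the product rule; the remaining
        factors lie in [0, 1], so each coefficient changes by at most \<open>D k\<close>.\<close>
      have 1: "(1 - a') * b' - (1 - a) * b = (1 - a') * (b' - b) - b * (a' - a)"
        and 2: "(1 - a') * (1 - b') - (1 - a) * (1 - b) = - ((1 - a') * (b' - b) + (1 - b) * (a' - a))"
        by (simp_all add: algebra_simps)
      have bb: "\<bar>(1 - a') * (b' - b)\<bar> \<le> \<bar>b' - b\<bar>" "\<bar>b * (a' - a)\<bar> \<le> \<bar>a' - a\<bar>"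
          "\<bar>(1 - b) * (a' - a)\<bar> \<le> \<bar>a' - a\<bar>"
        using ab by (auto simp: abs_mult intro!: mult_left_le_one_le)
      have "\<bar>a' - a\<bar> \<le> D k" "\<bar>(1 - a') * b' - (1 - a) * b\<bar> \<le> D k"
          "\<bar>(1 - a') * (1 - b') - (1 - a) * (1 - b)\<bar> \<le> D k"
        unfolding 1 2 using bb by (simp_all add: D_def a_def b_def a'_def b'_def)
      moreover have "norm (S X) \<le> BS" "norm (T X) \<le> BT" "norm (W X) \<le> BW"
        using BS BT BW by (auto simp: X_def)
      moreover have "norm (S X' - S X) \<le> r * z k" "norm (T X' - T X) \<le> z k" "norm (W X' - W X) \<le> z k"
        using S T W by (auto simp: X_def X'_def z_def)
      moreover have "0 \<le> D k" by (simp add: D_def)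
      ultimately have
        "\<bar>a' - a\<bar> * norm (S X) \<le> D k * BS"
        "\<bar>(1 - a') * b' - (1 - a) * b\<bar> * norm (T X) \<le> D k * BT"
        "\<bar>(1 - a') * (1 - b') - (1 - a) * (1 - b)\<bar> * norm (W X) \<le> D k * BW"
        "a' * norm (S X' - S X) \<le> a' * (r * z k)"
        "((1 - a') * b') * norm (T X' - T X) \<le> ((1 - a') * b') * z k"
        "((1 - a') * (1 - b')) * norm (W X' - W X) \<le> ((1 - a') * (1 - b')) * z k"
        using ab by (simp_all add: mult_mono mult_left_mono)
      then show ?thesis by linarith
    qed
    also have "\<dots> = (1 - \<gamma> (Suc k)) * z k + B * D k"
      by (simp add: B_def \<gamma>_def a'_def algebra_simps)
    finally show ?thesis .
  qed

  \<comment> \<open>Vanishing differences, first absolutely and then relative to \<beta>\<close>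
  have D_\<gamma>\<beta>: "(\<lambda>k. B * D k / (\<gamma> (Suc k) * \<beta> (Suc k))) \<longlonglongrightarrow> 0"
  proof -
    have "(\<lambda>k. B / (1 - r) * (D k / (\<alpha> (Suc k) * \<beta> (Suc k)))) \<longlonglongrightarrow> B / (1 - r) * 0"
      using diff_cond by (intro tendsto_mult tendsto_const) (simp add: D_def)
    then show ?thesis by (simp add: \<gamma>_def mult_ac)
  qed
  \<comment> \<open>As \<beta> is below 1, the error of the undivided recursion is dominated by that
    of the divided one.\<close>
  have D_\<gamma>: "B * D k / \<gamma> (Suc k) \<le> B * D k / (\<gamma> (Suc k) * \<beta> (Suc k))" for k
  proof -
    have "B * D k / \<gamma> (Suc k) * \<beta> (Suc k) \<le> B * D k / \<gamma> (Suc k)"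
      using \<gamma>[of "Suc k"] \<beta>[of "Suc k"] \<open>0 < B\<close> by (intro mult_left_le) (auto simp: D_def)
    then have "B * D k / \<gamma> (Suc k) \<le> B * D k / \<gamma> (Suc k) / \<beta> (Suc k)"
      using \<beta>[of "Suc k"] by (simp only: pos_le_divide_eq)
    then show ?thesis by (simp only: divide_divide_eq_left)
  qed

  have z0: "z \<longlonglongrightarrow> 0"
  proof (rule Xu_recursion_tendsto_0[OF _ _ _ \<gamma>_Suc_sum])
    show "z (Suc k) \<le> (1 - \<gamma> (Suc k)) * z k + \<gamma> (Suc k) * (B * D k / \<gamma> (Suc k))" for k
      using step[of k] \<gamma>[of "Suc k"] by simp
    fix e :: real assume "0 < e"
    then have "\<forall>\<^sub>F k in sequentially. B * D k / (\<gamma> (Suc k) * \<beta> (Suc k)) < e"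
      using D_\<gamma>\<beta> by (intro order_tendstoD(2))
    then show "\<forall>\<^sub>F k in sequentially. B * D k / \<gamma> (Suc k) \<le> e"
      by eventually_elim (use D_\<gamma> in \<open>meson le_less_trans less_imp_le\<close>)
  qed (use \<gamma> in \<open>auto simp: z_def less_imp_le\<close>)

  have \<zeta>0: "(\<lambda>k. z k / \<beta> k) \<longlonglongrightarrow> 0"
  proof (rule Xu_recursion_tendsto_0[OF _ _ _ \<gamma>_Suc_sum])
    \<comment> \<open>Replacing \<open>1 / \<beta> (Suc k)\<close> by \<open>1 / \<beta> k\<close>
      costs at most \<open>z k\<close> times the jump of \<open>1 / \<beta>\<close>, which is
      \<open>\<gamma> (Suc k) * (z k * \<kappa> k / (1 - r))\<close>. As \<kappa> is only eventually
      bounded, \<open>z0\<close> is what makes this error vanish relative to the rate.\<close>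
    define \<kappa> where "\<kappa> = (\<lambda>k. 1 / \<alpha> (Suc k) * \<bar>1 / \<beta> (Suc k) - 1 / \<beta> k\<bar>)"
    show "z (Suc k) / \<beta> (Suc k) \<le> (1 - \<gamma> (Suc k)) * (z k / \<beta> k)
        + \<gamma> (Suc k) * (z k * \<kappa> k / (1 - r) + B * D k / (\<gamma> (Suc k) * \<beta> (Suc k)))" for k
    proof -
      have "z (Suc k) / \<beta> (Suc k) \<le> ((1 - \<gamma> (Suc k)) * z k + B * D k) / \<beta> (Suc k)"
        using step[of k] \<beta>[of "Suc k"] by (intro divide_right_mono) auto
      also have "\<dots> = (1 - \<gamma> (Suc k)) * (z k * (1 / \<beta> (Suc k))) + B * D k / \<beta> (Suc k)"
        by (simp add: add_divide_distrib)
      also have "\<dots> \<le> (1 - \<gamma> (Suc k)) * (z k * (1 / \<beta> k)) + z k * \<bar>1 / \<beta> (Suc k) - 1 / \<beta> k\<bar> + B * D k / \<beta> (Suc k)"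
      proof -
        have "z k * (1 / \<beta> (Suc k) - 1 / \<beta> k) \<le> z k * \<bar>1 / \<beta> (Suc k) - 1 / \<beta> k\<bar>"
          by (intro mult_left_mono) (auto simp: z_def)
        then have "(1 - \<gamma> (Suc k)) * (z k * (1 / \<beta> (Suc k) - 1 / \<beta> k))
            \<le> (1 - \<gamma> (Suc k)) * (z k * \<bar>1 / \<beta> (Suc k) - 1 / \<beta> k\<bar>)"
          using \<gamma>[of "Suc k"] by (intro mult_left_mono) (auto simp: z_def)
        also have "\<dots> \<le> z k * \<bar>1 / \<beta> (Suc k) - 1 / \<beta> k\<bar>"
          using \<gamma>[of "Suc k"] by (intro mult_left_le_one_le) (auto simp: z_def)
        finally show ?thesis by (simp add: right_diff_distrib)
      qed
      also have "\<dots> = (1 - \<gamma> (Suc k)) * (z k / \<beta> k)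
        + \<gamma> (Suc k) * (z k * \<kappa> k / (1 - r) + B * D k / (\<gamma> (Suc k) * \<beta> (Suc k)))"
      proof -
        have "\<gamma> (Suc k) * (z k * \<kappa> k / (1 - r)) = z k * \<bar>1 / \<beta> (Suc k) - 1 / \<beta> k\<bar>"
          using r \<alpha>(1)[of "Suc k"] by (simp add: \<gamma>_def \<kappa>_def)
        moreover have "\<gamma> (Suc k) * (B * D k / (\<gamma> (Suc k) * \<beta> (Suc k))) = B * D k / \<beta> (Suc k)"
          using \<gamma>(1)[of "Suc k"] by simp
        ultimately show ?thesis by (simp add: distrib_left)
      qed
      finally show ?thesis .
    qed
    have "(\<lambda>k. z k * \<kappa> k) \<longlonglongrightarrow> 0"
    proof (rule tendsto_0_le[OF z0])
      show "\<forall>\<^sub>F k in sequentially. norm (z k * \<kappa> k) \<le> norm (z k) * K"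
        using K_cond
      proof eventually_elim
        case (elim k)
        have "0 \<le> \<kappa> k" using \<alpha>(1)[of "Suc k"] by (simp add: \<kappa>_def)
        moreover have "\<kappa> k \<le> K" using elim by (simp add: \<kappa>_def)
        ultimately show ?case by (simp add: abs_mult mult_left_mono)
      qed
    qed
    then have "(\<lambda>k. z k * \<kappa> k / (1 - r) + B * D k / (\<gamma> (Suc k) * \<beta> (Suc k))) \<longlonglongrightarrow> 0 / (1 - r) + 0"
      using D_\<gamma>\<beta> r by (intro tendsto_intros) auto
    then show "\<forall>\<^sub>F k in sequentially. z k * \<kappa> k / (1 - r) + B * D k / (\<gamma> (Suc k) * \<beta> (Suc k)) \<le> e"
      if "0 < e" for e
      using that by (auto dest!: order_tendstoD(2)[where a = e] elim!: eventually_mono)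
  qed (use \<gamma> \<beta> in \<open>auto simp: z_def less_imp_le\<close>)

  have \<alpha>\<beta>0: "(\<lambda>k. \<alpha> k / \<beta> k) \<longlonglongrightarrow> 0"
    using tendsto_inverse_0_at_top[OF ratio_inf] by simp
  have \<beta>0: "\<beta> \<longlonglongrightarrow> 0"
  proof -
    have "(\<lambda>k. (\<beta> k)\<^sup>2) \<longlonglongrightarrow> 0"
    proof (rule tendsto_0_le[OF \<alpha>_zero])
      show "\<forall>\<^sub>F k in sequentially. norm ((\<beta> k)\<^sup>2) \<le> norm (\<alpha> k) * M"
        using A2 by eventually_elim (simp add: \<alpha>(1) abs_of_pos pos_divide_le_eq mult.commute)
    qed
    then show ?thesis by (simp add: power_tendsto_0_iff)
  qed

  \<comment> \<open>Limit points of the orbit lie in \<Omega>\<close>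
  have limit_point: "l \<in> \<Omega>" if q: "strict_mono q" and lim: "(x \<circ> q) \<longlonglongrightarrow> l" for l q
  proof -
    have contT: "isCont T y" and contW: "isCont W y" for y
      using nonexpansive_imp_continuous_on[OF T, of UNIV] nonexpansive_imp_continuous_on[OF W, of UNIV]
      by (auto simp: continuous_on_eq_continuous_at)
    have xq: "(\<lambda>n. x (q n)) \<longlonglongrightarrow> l" using lim by (simp add: o_def)
    have sub: "(\<lambda>n. f (q n)) \<longlonglongrightarrow> c" if "f \<longlonglongrightarrow> c" for f :: "nat \<Rightarrow> 'b::topological_space" and c
      using LIMSEQ_subseq_LIMSEQ[OF that q] by (simp add: o_def)
    have Tq: "(\<lambda>n. T (x (q n))) \<longlonglongrightarrow> T l" and Wq: "(\<lambda>n. W (x (q n))) \<longlonglongrightarrow> W l"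
      using contT contW by (auto intro: isCont_tendsto_compose[OF _ xq])
    have Sq: "(\<lambda>n. S (x (q n))) \<longlonglongrightarrow> S l"
      using nonexpansive_imp_continuous_on[OF S1, of UNIV]
      by (auto simp: continuous_on_eq_continuous_at intro: isCont_tendsto_compose[OF _ xq])
    have "(\<lambda>n. x (Suc (q n)) - x (q n)) \<longlonglongrightarrow> 0"
      using sub[OF z0] by (simp add: z_def tendsto_norm_zero_iff)
    from tendsto_add[OF this xq] have "(\<lambda>n. x (Suc (q n))) \<longlonglongrightarrow> l" by simp
    \<comment> \<open>The three coefficients tend to 0, 0 and 1, so the limit of the iteration
      identity is \<open>l = W l\<close>.\<close>
    moreover have "(\<lambda>n. x (Suc (q n))) \<longlonglongrightarrow> 0 *\<^sub>R S l + ((1 - 0) * 0) *\<^sub>R T l + ((1 - 0) * (1 - 0)) *\<^sub>R W l"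
      unfolding iter using sub[OF \<alpha>_zero] sub[OF \<beta>0] Sq Tq Wq by (intro tendsto_intros)
    ultimately have "l = 0 *\<^sub>R S l + ((1 - 0) * 0) *\<^sub>R T l + ((1 - 0) * (1 - 0)) *\<^sub>R W l"
      by (rule LIMSEQ_unique)
    then have "W l = l" by simp
    moreover have "0 \<le> (l - T l) \<bullet> (y - l)" if y: "y \<in> Fix W" for y
    proof -
      \<comment> \<open>This is what bounds the \<open>T\<close> term after pairing the iteration
        with \<open>x k - y\<close> and dividing by \<open>\<beta> k\<close>. The \<open>W\<close>
        term is nonnegative by monotonicity and is dropped; the step length carries
        \<open>z k / \<beta> k\<close> and the \<open>S\<close> term carries
        \<open>\<alpha> k / \<beta> k\<close>, both of which vanish.\<close>
      define \<eta> where "\<eta> = (\<lambda>k. z k / \<beta> k * norm (x k - y) - (\<alpha> k / \<beta> k) * ((x k - S (x k)) \<bullet> (x k - y)))"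
      have ineq: "(1 - \<alpha> k) * ((x k - T (x k)) \<bullet> (x k - y)) \<le> \<eta> k" for k
      proof -
        have "0 \<le> ((x k - W (x k)) - (y - W y)) \<bullet> (x k - y)"
          by (rule nonexpansive_complement_monotone[OF W])
        then have mono: "0 \<le> (x k - W (x k)) \<bullet> (x k - y)" using y by (simp add: Fix_def)
        have "x k - x (Suc k) = \<alpha> k *\<^sub>R (x k - S (x k)) + ((1 - \<alpha> k) * \<beta> k) *\<^sub>R (x k - T (x k))
            + ((1 - \<alpha> k) * (1 - \<beta> k)) *\<^sub>R (x k - W (x k))"
          unfolding iter by (simp add: algebra_simps)
        then have "(x k - x (Suc k)) \<bullet> (x k - y) = \<alpha> k * ((x k - S (x k)) \<bullet> (x k - y))
            + ((1 - \<alpha> k) * \<beta> k) * ((x k - T (x k)) \<bullet> (x k - y))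
            + ((1 - \<alpha> k) * (1 - \<beta> k)) * ((x k - W (x k)) \<bullet> (x k - y))"
          by (simp only: inner_add_left inner_scaleR_left)
        moreover have "0 \<le> ((1 - \<alpha> k) * (1 - \<beta> k)) * ((x k - W (x k)) \<bullet> (x k - y))"
          using \<alpha>[of k] \<beta>[of k] mono by simp
        moreover have "(x k - x (Suc k)) \<bullet> (x k - y) \<le> z k * norm (x k - y)"
          using norm_cauchy_schwarz[of "x k - x (Suc k)" "x k - y"] by (simp add: z_def norm_minus_commute)
        ultimately have "((1 - \<alpha> k) * \<beta> k) * ((x k - T (x k)) \<bullet> (x k - y))
            \<le> z k * norm (x k - y) - \<alpha> k * ((x k - S (x k)) \<bullet> (x k - y))" by linarith
        also have "\<dots> = \<beta> k * \<eta> k"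
          using \<beta>(1)[of k] by (simp add: \<eta>_def right_diff_distrib)
        finally have "\<beta> k * ((1 - \<alpha> k) * ((x k - T (x k)) \<bullet> (x k - y))) \<le> \<beta> k * \<eta> k"
          by (simp add: mult_ac)
        then show ?thesis using \<beta>(1)[of k] by simp
      qed
      have \<eta>_lim: "(\<lambda>n. \<eta> (q n)) \<longlonglongrightarrow> 0 * norm (l - y) - 0 * ((l - S l) \<bullet> (l - y))"
        unfolding \<eta>_def using sub[OF \<zeta>0] sub[OF \<alpha>\<beta>0] xq Sq by (intro tendsto_intros)
      have "(\<lambda>n. (1 - \<alpha> (q n)) * ((x (q n) - T (x (q n))) \<bullet> (x (q n) - y)))
          \<longlonglongrightarrow> (1 - 0) * ((l - T l) \<bullet> (l - y))"
        using sub[OF \<alpha>_zero] xq Tq by (intro tendsto_intros)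
      from this \<eta>_lim have "(1 - 0) * ((l - T l) \<bullet> (l - y)) \<le> 0 * norm (l - y) - 0 * ((l - S l) \<bullet> (l - y))"
        by (rule LIMSEQ_le) (use ineq in blast)
      then show ?thesis by (simp add: inner_diff_right)
    qed
    ultimately show ?thesis by (simp add: \<Omega>_def Fix_def)
  qed

  \<comment> \<open>Recursion for the squared distance to the solution\<close>
  have xsW: "xs \<in> Fix W" and xsVI: "\<And>y. y \<in> Fix W \<Longrightarrow> 0 \<le> (xs - T xs) \<bullet> (y - xs)"
    using xs(1) by (auto simp: \<Omega>_def)
  define N where "N = norm (xs - T xs)"
  define d where "d = (\<lambda>k. infdist (x (Suc k)) (Fix W))"
  \<comment> \<open>The iterate is replaced by a nearest point \<open>p\<close> of
    \<open>Fix W\<close>; the inequality solved by \<open>xs\<close>, tested at \<open>p\<close>,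
    gives the right sign to the part along \<open>p - xs\<close>.\<close>
  have dT: "(T xs - xs) \<bullet> (x (Suc k) - xs) \<le> N * d k" for k
  proof -
    obtain p where p: "p \<in> Fix W" "d k = dist (x (Suc k)) p"
      using infdist_attains_inf[OF Fix_nonexpansive_closed_convex(1)[OF W]] xsW unfolding d_def by blast
    have "(T xs - xs) \<bullet> (x (Suc k) - xs) \<le> (T xs - xs) \<bullet> (x (Suc k) - p)"
      using xsVI[OF p(1)] by (simp add: inner_simps)
    also have "\<dots> \<le> N * d k"
      using norm_cauchy_schwarz[of "T xs - xs" "x (Suc k) - p"]
      by (simp add: N_def p(2) dist_norm norm_minus_commute)
    finally show ?thesis .
  qed

  have "(\<lambda>k. (norm (x k - xs))\<^sup>2) \<longlonglongrightarrow> 0"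
  proof (rule Xu_recursion_tendsto_0[OF _ _ _ \<gamma>_sum])
    \<comment> \<open>The factor \<open>2 / (1 - r)\<close> converts \<open>\<alpha> k\<close> into
      \<open>\<gamma> k\<close>. The error \<open>\<beta> k * (N * d k)\<close> is written as
      \<open>\<alpha> k\<close> times the bounded ratio
      \<open>(\<beta> k)\<^sup>2 / \<alpha> k\<close> times a null sequence.\<close>
    define \<delta> where "\<delta> = (\<lambda>k. 2 / (1 - r) * ((S xs - xs) \<bullet> (x (Suc k) - xs) + (\<beta> k)\<^sup>2 / \<alpha> k * (N * (d k / \<beta> k))))"
    show "(norm (x (Suc k) - xs))\<^sup>2 \<le> (1 - \<gamma> k) * (norm (x k - xs))\<^sup>2 + \<gamma> k * \<delta> k" for k
    proof -
      define a b X where "a = \<alpha> k" and "b = \<beta> k" and "X = x k"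
      have ab: "0 < a" "a < 1" "0 < b" "b < 1" using \<alpha> \<beta> by (auto simp: a_def b_def)
      \<comment> \<open>\<open>P\<close> collects the differences from the images of
        \<open>xs\<close>, \<open>Q\<close> the residuals at \<open>xs\<close>. \<open>W\<close>
        leaves no residual, as \<open>W xs = xs\<close>.\<close>
      define P where "P = a *\<^sub>R (S X - S xs) + ((1 - a) * b) *\<^sub>R (T X - T xs) + ((1 - a) * (1 - b)) *\<^sub>R (W X - xs)"
      define Q where "Q = a *\<^sub>R (S xs - xs) + ((1 - a) * b) *\<^sub>R (T xs - xs)"
      have PQ: "x (Suc k) - xs = P + Q"
        unfolding iter P_def Q_def by (simp add: X_def a_def b_def algebra_simps)
      have "norm P \<le> a * norm (S X - S xs) + ((1 - a) * b) * norm (T X - T xs) + ((1 - a) * (1 - b)) * norm (W X - xs)"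
        unfolding P_def using ab by (intro norm_add_rule_thm order_eq_refl) (auto simp: abs_mult)
      also have "\<dots> \<le> a * (r * norm (X - xs)) + ((1 - a) * b) * norm (X - xs) + ((1 - a) * (1 - b)) * norm (X - xs)"
        using ab S[of X xs] T[of X xs] W[of X xs] xsW
        by (intro add_mono mult_left_mono) (auto simp: Fix_def)
      also have "\<dots> = (1 - \<gamma> k) * norm (X - xs)"
        by (simp add: \<gamma>_def a_def algebra_simps)
      finally have "(norm P)\<^sup>2 \<le> ((1 - \<gamma> k) * norm (X - xs))\<^sup>2"
        by (intro power_mono) auto
      also have "\<dots> = (1 - \<gamma> k) * ((1 - \<gamma> k) * (norm (X - xs))\<^sup>2)"
        by (simp add: power2_eq_square)
      also have "\<dots> \<le> (1 - \<gamma> k) * (norm (X - xs))\<^sup>2"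
        using \<gamma>[of k] by (intro mult_left_mono mult_left_le_one_le) auto
      finally have normP: "(norm P)\<^sup>2 \<le> (1 - \<gamma> k) * (norm (X - xs))\<^sup>2" .
      \<comment> \<open>The inner product keeps the whole of \<open>P + Q\<close>, the error of the
        next iterate, so that \<open>dT\<close> and the limit point argument apply to it.\<close>
      have "(norm (P + Q))\<^sup>2 \<le> (norm P)\<^sup>2 + 2 * (Q \<bullet> (P + Q))"
        unfolding power2_norm_eq_inner using inner_ge_zero[of Q] by (simp add: inner_simps inner_commute)
      also have "Q \<bullet> (P + Q) = a * ((S xs - xs) \<bullet> (x (Suc k) - xs)) + (1 - a) * (b * ((T xs - xs) \<bullet> (x (Suc k) - xs)))"
        by (simp add: PQ Q_def inner_add_left mult.assoc)
      also have "(1 - a) * (b * ((T xs - xs) \<bullet> (x (Suc k) - xs))) \<le> (1 - a) * (b * (N * d k))"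
        using ab dT[of k] by (intro mult_left_mono) auto
      also have "\<dots> \<le> b * (N * d k)"
        using ab by (intro mult_left_le_one_le) (auto simp: N_def d_def infdist_nonneg)
      also have "\<dots> = a * (b\<^sup>2 / a * (N * (d k / b)))"
        using ab by (simp add: power2_eq_square)
      finally have "(norm (x (Suc k) - xs))\<^sup>2 \<le> (norm P)\<^sup>2
          + 2 * (a * ((S xs - xs) \<bullet> (x (Suc k) - xs)) + a * (b\<^sup>2 / a * (N * (d k / b))))"
        by (simp add: PQ)
      also have "2 * (a * ((S xs - xs) \<bullet> (x (Suc k) - xs)) + a * (b\<^sup>2 / a * (N * (d k / b)))) = \<gamma> k * \<delta> k"
      proof -
        have "\<gamma> k * \<delta> k = (1 - r) * (2 / (1 - r)) * (a * ((S xs - xs) \<bullet> (x (Suc k) - xs) + b\<^sup>2 / a * (N * (d k / b))))"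
          by (simp only: \<gamma>_def \<delta>_def a_def b_def mult_ac)
        also have "(1 - r) * (2 / (1 - r)) = 2" using r by (simp add: field_simps)
        finally show ?thesis by (simp add: distrib_left)
      qed
      finally show ?thesis using normP by (simp add: X_def)
    qed
    fix e :: real assume "0 < e"
    \<comment> \<open>Two terms of size \<open>e'\<close>, multiplied by \<open>2 / (1 - r)\<close>,
      add up to \<open>e\<close>.\<close>
    define e' where "e' = e * (1 - r) / 4"
    have "0 < e'" using \<open>0 < e\<close> r by (simp add: e'_def)
    have "\<forall>\<^sub>F k in sequentially. (S xs - xs) \<bullet> (x k - xs) \<le> e'"
    proof (rule eventually_le_if_limit_points_nonpos[OF x_bdd _ _ \<open>0 < e'\<close>])
      show "continuous_on UNIV (\<lambda>y. (S xs - xs) \<bullet> (y - xs))" by (intro continuous_intros)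
      show "(S xs - xs) \<bullet> (l - xs) \<le> 0" if "strict_mono q" "(x \<circ> q) \<longlonglongrightarrow> l" for l q
        using xs(2)[OF limit_point[OF that]] by (simp add: inner_diff_left)
    qed
    then have ev1: "\<forall>\<^sub>F k in sequentially. (S xs - xs) \<bullet> (x (Suc k) - xs) \<le> e'"
      using eventually_compose_filterlim[OF _ filterlim_Suc] by blast
    have "(\<lambda>k. N * (d k / \<beta> k)) \<longlonglongrightarrow> 0"
      using tendsto_mult_right_zero[OF A1] by (simp add: d_def)
    then have "(\<lambda>k. (\<beta> k)\<^sup>2 / \<alpha> k * (N * (d k / \<beta> k))) \<longlonglongrightarrow> 0"
    proof (rule tendsto_0_le)
      show "\<forall>\<^sub>F k in sequentially. norm ((\<beta> k)\<^sup>2 / \<alpha> k * (N * (d k / \<beta> k))) \<le> norm (N * (d k / \<beta> k)) * M"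
        using A2
      proof eventually_elim
        case (elim k)
        have "0 \<le> (\<beta> k)\<^sup>2 / \<alpha> k" using \<alpha>(1)[of k] by simp
        then have "norm ((\<beta> k)\<^sup>2 / \<alpha> k * (N * (d k / \<beta> k))) = norm (N * (d k / \<beta> k)) * ((\<beta> k)\<^sup>2 / \<alpha> k)"
          by (subst mult.commute) (simp only: real_norm_def abs_mult abs_of_nonneg)
        also have "\<dots> \<le> norm (N * (d k / \<beta> k)) * M" using elim by (intro mult_left_mono) auto
        finally show ?case .
      qed
    qed
    then have "\<forall>\<^sub>F k in sequentially. (\<beta> k)\<^sup>2 / \<alpha> k * (N * (d k / \<beta> k)) < e'"
      using \<open>0 < e'\<close> by (intro order_tendstoD(2))
    with ev1 show "\<forall>\<^sub>F k in sequentially. \<delta> k \<le> e"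
    proof eventually_elim
      case (elim k)
      then have "\<delta> k \<le> 2 / (1 - r) * (e' + e')"
        unfolding \<delta>_def using r by (intro mult_left_mono) auto
      also have "\<dots> = e" using r by (simp add: e'_def field_simps)
      finally show ?case .
    qed
  qed (use \<gamma> in \<open>auto simp: less_imp_le\<close>)
  then have "(\<lambda>k. norm (x k - xs)) \<longlonglongrightarrow> 0"
    by (simp add: power_tendsto_0_iff)
  then show "x \<longlonglongrightarrow> xs"
    by (simp add: tendsto_norm_zero_iff LIM_zero_iff)
qed

section \<open>Application to the gradient and proximal gradient operators\<close>

theorem mainTheorem8:
  fixes f1 f2 \<omega> :: "'a::euclidean_space \<Rightarrow> real"
    and gf1 gf2 g\<omega> :: "'a \<Rightarrow> 'a"
    and g1 g2 :: "'a \<Rightarrow> ereal"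
    and Lf1 Lf2 L\<omega> \<mu> u t s :: real
    and \<alpha> \<beta> :: "nat \<Rightarrow> real"
    and x :: "nat \<Rightarrow> 'a"
    and S T W :: "'a \<Rightarrow> 'a"
    and Ystar Xstar \<Omega> :: "'a set"
  assumes f1_convex: "convex_on UNIV f1"
    and f2_convex: "convex_on UNIV f2"
    and f1_grad: "\<And>z. (f1 has_derivative (\<lambda>h. gf1 z \<bullet> h)) (at z)"
    and f2_grad: "\<And>z. (f2 has_derivative (\<lambda>h. gf2 z \<bullet> h)) (at z)"
    and f1_cont: "continuous_on UNIV gf1"
    and f2_cont: "continuous_on UNIV gf2"
    and Lf1_pos: "Lf1 > 0" and Lf2_pos: "Lf2 > 0"
    and f1_lip: "\<And>y z. norm (gf1 y - gf1 z) \<le> Lf1 * norm (y - z)"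
    and f2_lip: "\<And>y z. norm (gf2 y - gf2 z) \<le> Lf2 * norm (y - z)"
    and g1_proper: "proper_fun g1" and g1_lsc: "lsc_fun g1" and g1_convex: "ereal_convex g1"
    and g2_proper: "proper_fun g2" and g2_lsc: "lsc_fun g2" and g2_convex: "ereal_convex g2"
    and \<mu>_pos: "\<mu> > 0"
    and \<omega>_sc: "strongly_convex \<mu> \<omega>"
    and \<omega>_grad: "\<And>z. (\<omega> has_derivative (\<lambda>h. g\<omega> z \<bullet> h)) (at z)"
    and \<omega>_cont: "continuous_on UNIV g\<omega>"
    and L\<omega>_pos: "L\<omega> > 0"
    and \<omega>_lip: "\<And>y z. norm (g\<omega> y - g\<omega> z) \<le> L\<omega> * norm (y - z)"
    and Ystar_def: "Ystar = {y. \<forall>z. ereal (f2 y) + g2 y \<le> ereal (f2 z) + g2 z}"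
    and Xstar_def: "Xstar = {y \<in> Ystar. \<forall>z\<in>Ystar. ereal (f1 y) + g1 y \<le> ereal (f1 z) + g1 z}"
    and Ystar_ne: "Ystar \<noteq> {}"
    and Xstar_ne: "Xstar \<noteq> {}"
    and u_range: "0 < u" "u \<le> 2 / (L\<omega> + \<mu>)"
    and t_range: "0 < t" "t \<le> 1 / Lf1"
    and s_range: "0 < s" "s \<le> 1 / Lf2"
    and S_def: "\<And>z. S z = z - u *\<^sub>R g\<omega> z"
    and T_def: "\<And>z. T z = prox (\<lambda>v. ereal t * g1 v) (z - t *\<^sub>R gf1 z)"
    and W_def: "\<And>z. W z = prox (\<lambda>v. ereal s * g2 v) (z - s *\<^sub>R gf2 z)"
    and \<alpha>_range: "\<And>k. 0 < \<alpha> k \<and> \<alpha> k < 1"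
    and \<beta>_range: "\<And>k. 0 < \<beta> k \<and> \<beta> k < 1"
    and iter: "\<And>k. x (Suc k) = \<alpha> k *\<^sub>R S (x k) + ((1 - \<alpha> k) * \<beta> k) *\<^sub>R T (x k)
                               + ((1 - \<alpha> k) * (1 - \<beta> k)) *\<^sub>R W (x k)"
    and \<Omega>_def: "\<Omega> = {z \<in> Fix W. \<forall>y\<in>Fix W. (z - T z) \<bullet> (y - z) \<ge> 0}"
    and \<Omega>_ne: "\<Omega> \<noteq> {}"
    and ratio_inf: "filterlim (\<lambda>k. \<beta> k / \<alpha> k) at_top sequentially"
    and \<alpha>_zero: "\<alpha> \<longlonglongrightarrow> 0"
    and \<alpha>_sum: "filterlim (\<lambda>n. \<Sum>k<n. \<alpha> k) at_top sequentially"
    and K_cond: "\<exists>K>0. limsup (\<lambda>k. ereal (1 / \<alpha> (Suc k) * \<bar>1 / \<beta> (Suc k) - 1 / \<beta> k\<bar>)) \<le> ereal K"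
    and diff_cond: "limsup (\<lambda>k. ereal ((\<bar>\<beta> (Suc k) - \<beta> k\<bar> + \<bar>\<alpha> (Suc k) - \<alpha> k\<bar>)
                                        / (\<alpha> (Suc k) * \<beta> (Suc k)))) = 0"
    and x_bdd: "bounded (range x)"
    and A1': "limsup (\<lambda>k. ereal (infdist (x (Suc k)) (Fix W) / \<beta> k)) = 0"
    and A2: "limsup (\<lambda>k. ereal ((\<beta> k)\<^sup>2 / \<alpha> k)) < \<infinity>"
  shows "\<exists>xs. xs \<in> \<Omega> \<and> (\<forall>z\<in>\<Omega>. (xs - S xs) \<bullet> (z - xs) \<ge> 0)
            \<and> (\<forall>xs'. xs' \<in> \<Omega> \<and> (\<forall>z\<in>\<Omega>. (xs' - S xs') \<bullet> (z - xs') \<ge> 0) \<longrightarrow> xs' = xs)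
            \<and> x \<longlonglongrightarrow> xs"
proof -
  have T: "norm (T y - T z) \<le> norm (y - z)" for y z
    unfolding T_def using Lf1_pos t_range
    by (intro forward_backward_nonexpansive[OF g1_proper g1_lsc g1_convex f1_convex f1_grad f1_lip]) auto
  have W: "norm (W y - W z) \<le> norm (y - z)" for y z
    unfolding W_def using Lf2_pos s_range
    by (intro forward_backward_nonexpansive[OF g2_proper g2_lsc g2_convex f2_convex f2_grad f2_lip]) auto
  obtain r where r: "0 \<le> r" "r < 1" and S: "\<And>y z. norm (S y - S z) \<le> r * norm (y - z)"
    using gradient_step_contraction[OF \<omega>_sc \<mu>_pos \<omega>_grad \<omega>_lip u_range] unfolding S_def by blast
  have "continuous_on UNIV (\<lambda>z. z - T z)"
    using nonexpansive_imp_continuous_on[OF T] by (intro continuous_intros)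
  then have \<Omega>_closed_convex: "closed \<Omega>" "convex \<Omega>"
    unfolding \<Omega>_def
    by (intro variational_inequality_solutions_closed_convex Fix_nonexpansive_closed_convex W
        nonexpansive_complement_monotone T; assumption)+
  obtain xs where xs: "xs \<in> \<Omega>" "\<And>z. z \<in> \<Omega> \<Longrightarrow> (xs - S xs) \<bullet> (z - xs) \<ge> 0"
    and unique: "\<And>p. p \<in> \<Omega> \<Longrightarrow> \<forall>z\<in>\<Omega>. (p - S p) \<bullet> (z - p) \<ge> 0 \<Longrightarrow> p = xs"
    using contraction_variational_inequality_unique[OF \<Omega>_closed_convex \<Omega>_ne r S] by blast
  have "limsup (\<lambda>k. ereal (1 / \<alpha> (Suc k) * \<bar>1 / \<beta> (Suc k) - 1 / \<beta> k\<bar>)) < \<infinity>"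
    using K_cond by (auto elim: le_less_trans)
  then obtain K where K: "\<forall>\<^sub>F k in sequentially. 1 / \<alpha> (Suc k) * \<bar>1 / \<beta> (Suc k) - 1 / \<beta> k\<bar> \<le> K"
    by (rule limsup_ereal_finite_imp_eventually_le)
  obtain M where M: "\<forall>\<^sub>F k in sequentially. (\<beta> k)\<^sup>2 / \<alpha> k \<le> M"
    using A2 by (rule limsup_ereal_finite_imp_eventually_le)
  have "x \<longlonglongrightarrow> xs"
  proof (rule trilevel_iteration_tendsto[OF r S T W _ _ _ _ iter \<Omega>_def xs ratio_inf \<alpha>_zero \<alpha>_sum K _ x_bdd _ M])
    show "(\<lambda>k. (\<bar>\<beta> (Suc k) - \<beta> k\<bar> + \<bar>\<alpha> (Suc k) - \<alpha> k\<bar>) / (\<alpha> (Suc k) * \<beta> (Suc k))) \<longlonglongrightarrow> 0"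
      by (rule limsup_ereal_0_imp_tendsto_0[OF diff_cond])
         (intro divide_nonneg_pos mult_pos_pos; simp add: \<alpha>_range \<beta>_range)
    show "(\<lambda>k. infdist (x (Suc k)) (Fix W) / \<beta> k) \<longlonglongrightarrow> 0"
      by (rule limsup_ereal_0_imp_tendsto_0[OF A1'])
         (intro divide_nonneg_pos; simp add: \<beta>_range infdist_nonneg)
  qed (simp_all add: \<alpha>_range \<beta>_range)
  show ?thesis
  proof (intro exI conjI ballI allI impI)
    show "xs \<in> \<Omega>" "x \<longlonglongrightarrow> xs" by fact+
    show "(xs - S xs) \<bullet> (z - xs) \<ge> 0" if "z \<in> \<Omega>" for z using xs(2)[OF that] .
    show "p = xs" if "p \<in> \<Omega> \<and> (\<forall>z\<in>\<Omega>. (p - S p) \<bullet> (z - p) \<ge> 0)" for p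
      using unique that by (elim conjE)
  qed
qed

end
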